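(* Let $\Sigma_1,\Sigma_2$ be subsystems of the form $\dot x_i = A_i x_i + J_i z_j + B_i u_i$, $z_i = S_i x_i$, $y_i = C_i x_i + D_i z_j$ ($j\neq i$, $i,j\in\{1,2\}$), with $x_i\in\mathbb R^{n_i}$ and scalar signals $z_i,u_i,y_i\in\mathbb R$, and let $\Sigma$ be their interconnection. Suppose there exist local controllers $\kappa_1,\kappa_2$ such that $(\Sigma,\{\kappa_i\})$ is stable. Suppose that $(A_i,B_i)$ is controllable and $(A_i,C_i)$ is observable for each $i\in\{1,2\}$. Then $\Sigma$ is weakly resilient if and only if $\Sigma$ is a cascade system, i.e., for either $(i,j)=(1,2)$ or $(i,j)=(2,1)$ (at least one of them) it holds that $$J_iS_j=0\quad\text{and}\quad D_iS_j=0 .$$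
   Context: All matrices are real and of compatible dimensions: $A_i\in\mathbb R^{n_i\times n_i}$, $B_i,J_i\in\mathbb R^{n_i}$, $C_i,S_i\in\mathbb R^{1\times n_i}$, $D_i\in\mathbb R$. The interconnected system is $\Sigma:\ \dot x = Ax+Bu,\ y=Cx$ with $x=[x_1^{\sf T},x_2^{\sf T}]^{\sf T}$, $u=[u_1,u_2]^{\sf T}$, $y=[y_1,y_2]^{\sf T}$ and $$A=\begin{bmatrix} A_1 & J_1S_2 \\ J_2S_1 & A_2 \end{bmatrix},\quad B=\begin{bmatrix} B_1 & 0 \\ 0 & B_2 \end{bmatrix},\quad C=\begin{bmatrix} C_1 & D_1S_2 \\ D_2S_1 & C_2 \end{bmatrix}.$$ A local controller $\kappa_i: y_i\mapsto u_i$ is a finite-dimensional linear time-invariant system given in state-space form, $\dot\xi_i=K_i\xi_i+H_iy_i$, $u_i=M_i\xi_i+N_iy_i$, of arbitrary finite state dimension. $(\Sigma_i,\kappa_i)$ denotes the local closed-loop system, i.e. the feedback interconnection of $\Sigma_i$ and $\kappa_i$ disconnected from the other subsystem (with $z_j$, $j\ne i$, regarded as an external input). $(\Sigma,\{\kappa_i\})$ denotes the overall closed-loop system obtained by connecting $\kappa_1$ and $\kappa_2$ to $\Sigma$. A closed-loop system is called stable if it is internally stable, i.e. the state matrix of the joint (plant and controller) state-space model is Hurwitz. Set of locally stabilizing controllers: $\mathcal K_i:=\{\kappa_i : (\Sigma_i,\kappa_i)\text{ is stable}\}$, $i\in\{1,2\}$. Definition: $\Sigma$ is weakly resilient if $(\Sigma,\{\kappa_i\})$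 is stable for every $\kappa_1\in\mathcal K_1$ and every $\kappa_2\in\mathcal K_2$. *)

theory Defs
  imports Complex_Main "Jordan_Normal_Form.Char_Poly"
begin

definition hurwitz :: "real mat \<Rightarrow> bool" where
  "hurwitz A \<longleftrightarrow> (\<forall>z. eigenvalue (map_mat complex_of_real A) z \<longrightarrow> Re z < 0)"

text \<open>\<open>x' = A x + f\<close> on the interval from 0 to \<open>T\<close>, one-sided derivatives at the endpoints.\<close>

definition solves :: "real mat \<Rightarrow> (real \<Rightarrow> real vec) \<Rightarrow> real \<Rightarrow> (real \<Rightarrow> real vec) \<Rightarrow> bool" where
  "solves A f T x \<longleftrightarrow>
     (\<forall>t\<in>{0..T}. x t \<in> carrier_vec (dim_row A)) \<and>
     (\<forall>t\<in>{0..T}. \<forall>i<dim_row A.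
        ((\<lambda>s. x s $ i) has_real_derivative (A *\<^sub>v x t + f t) $ i) (at t within {0..T}))"

text \<open>Any state can be steered to any other one in any positive time. For linear systems,
  wider input classes (piecewise continuous, locally integrable) give the same notion.\<close>

definition controllable :: "real mat \<Rightarrow> real mat \<Rightarrow> bool" where
  "controllable A B \<longleftrightarrow>
     (\<forall>T>0. \<forall>x0 \<in> carrier_vec (dim_row A). \<forall>x1 \<in> carrier_vec (dim_row A).
        \<exists>u x. (\<forall>t\<in>{0..T}. u t \<in> carrier_vec (dim_col B)) \<and>
              (\<forall>k<dim_col B. continuous_on {0..T} (\<lambda>t. u t $ k)) \<and>
              solves A (\<lambda>t. B *\<^sub>v u t) T x \<and> x 0 = x0 \<and> x T = x1)"

text \<open>The output over any time interval of positive length determines the initial state. By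
  linearity a known input does not matter, so it is taken to be zero.\<close>

definition observable :: "real mat \<Rightarrow> real mat \<Rightarrow> bool" where
  "observable A C \<longleftrightarrow>
     (\<forall>T>0. \<forall>x x'.
        solves A (\<lambda>_. 0\<^sub>v (dim_row A)) T x \<longrightarrow>
        solves A (\<lambda>_. 0\<^sub>v (dim_row A)) T x' \<longrightarrow>
        (\<forall>t\<in>{0..T}. C *\<^sub>v x t = C *\<^sub>v x' t) \<longrightarrow> x 0 = x' 0)"

text \<open>A subsystem \<open>x' = A x + J z + B u\<close>, \<open>y = C x + D z\<close> with external input \<open>z\<close> and
  interconnection output \<open>S x\<close>; all signals are scalar.\<close>

record subsystem =
  sub_A :: "real mat"
  sub_B :: "real mat"
  sub_J :: "real mat"
  sub_C :: "real mat"
  sub_S :: "real mat"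
  sub_D :: real

definition is_subsystem :: "nat \<Rightarrow> subsystem \<Rightarrow> bool" where
  "is_subsystem n P \<longleftrightarrow>
     sub_A P \<in> carrier_mat n n \<and> sub_B P \<in> carrier_mat n 1 \<and> sub_J P \<in> carrier_mat n 1 \<and>
     sub_C P \<in> carrier_mat 1 n \<and> sub_S P \<in> carrier_mat 1 n"

text \<open>A controller \<open>\<xi>' = K \<xi> + H y\<close>, \<open>u = M \<xi> + N y\<close>.\<close>

record controller =
  ctr_K :: "real mat"
  ctr_H :: "real mat"
  ctr_M :: "real mat"
  ctr_N :: "real mat"

text \<open>The state dimension \<open>q\<close> is arbitrary; \<open>q = 0\<close> is static output feedback.\<close>

definition is_local_controller :: "controller \<Rightarrow> bool" where
  "is_local_controller \<kappa> \<longleftrightarrow>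
     (\<exists>q. ctr_K \<kappa> \<in> carrier_mat q q \<and> ctr_H \<kappa> \<in> carrier_mat q 1 \<and>
          ctr_M \<kappa> \<in> carrier_mat 1 q \<and> ctr_N \<kappa> \<in> carrier_mat 1 1)"

text \<open>State matrix, in the joint state \<open>(x, \<xi>)\<close>, of the plant \<open>x' = A x + B u\<close>, \<open>y = C x\<close> under
  \<open>u = M \<xi> + N y\<close>, \<open>\<xi>' = K \<xi> + H y\<close>.\<close>

definition closed_loop_mat ::
  "real mat \<Rightarrow> real mat \<Rightarrow> real mat \<Rightarrow> controller \<Rightarrow> real mat" where
  "closed_loop_mat A B C \<kappa> =
     four_block_mat (A + B * ctr_N \<kappa> * C) (B * ctr_M \<kappa>) (ctr_H \<kappa> * C) (ctr_K \<kappa>)"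

text \<open>The external input \<open>z\<close> enters the local closed loop additively, through \<open>J\<close> and \<open>D\<close>, so it
  does not affect the state matrix.\<close>

definition locally_stable :: "subsystem \<Rightarrow> controller \<Rightarrow> bool" where
  "locally_stable P \<kappa> \<longleftrightarrow> hurwitz (closed_loop_mat (sub_A P) (sub_B P) (sub_C P) \<kappa>)"

definition locally_stabilizing :: "subsystem \<Rightarrow> controller set" where
  "locally_stabilizing P = {\<kappa>. is_local_controller \<kappa> \<and> locally_stable P \<kappa>}"

definition sys_A :: "subsystem \<Rightarrow> subsystem \<Rightarrow> real mat" where
  "sys_A P1 P2 =
     four_block_mat (sub_A P1) (sub_J P1 * sub_S P2) (sub_J P2 * sub_S P1) (sub_A P2)"

definition sys_B :: "subsystem \<Rightarrow> subsystem \<Rightarrow> real mat" where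
  "sys_B P1 P2 = diag_block_mat [sub_B P1, sub_B P2]"

definition sys_C :: "subsystem \<Rightarrow> subsystem \<Rightarrow> real mat" where
  "sys_C P1 P2 =
     four_block_mat (sub_C P1) (sub_D P1 \<cdot>\<^sub>m sub_S P2) (sub_D P2 \<cdot>\<^sub>m sub_S P1) (sub_C P2)"

text \<open>The two controllers side by side, as one controller from \<open>(y1, y2)\<close> to \<open>(u1, u2)\<close>.\<close>

definition diag_controller :: "controller \<Rightarrow> controller \<Rightarrow> controller" where
  "diag_controller \<kappa>1 \<kappa>2 =
     \<lparr>ctr_K = diag_block_mat [ctr_K \<kappa>1, ctr_K \<kappa>2],
      ctr_H = diag_block_mat [ctr_H \<kappa>1, ctr_H \<kappa>2],
      ctr_M = diag_block_mat [ctr_M \<kappa>1, ctr_M \<kappa>2],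
      ctr_N = diag_block_mat [ctr_N \<kappa>1, ctr_N \<kappa>2]\<rparr>"

definition overall_stable ::
  "subsystem \<Rightarrow> subsystem \<Rightarrow> controller \<Rightarrow> controller \<Rightarrow> bool" where
  "overall_stable P1 P2 \<kappa>1 \<kappa>2 \<longleftrightarrow>
     hurwitz (closed_loop_mat (sys_A P1 P2) (sys_B P1 P2) (sys_C P1 P2)
       (diag_controller \<kappa>1 \<kappa>2))"

definition weakly_resilient :: "subsystem \<Rightarrow> subsystem \<Rightarrow> bool" where
  "weakly_resilient P1 P2 \<longleftrightarrow>
     (\<forall>\<kappa>1 \<in> locally_stabilizing P1. \<forall>\<kappa>2 \<in> locally_stabilizing P2.
        overall_stable P1 P2 \<kappa>1 \<kappa>2)"

definition decoupled_from :: "subsystem \<Rightarrow> subsystem \<Rightarrow> bool" where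
  "decoupled_from P Q \<longleftrightarrow>
     sub_J P * sub_S Q = 0\<^sub>m (dim_row (sub_J P)) (dim_col (sub_S Q)) \<and>
     sub_D P \<cdot>\<^sub>m sub_S Q = 0\<^sub>m 1 (dim_col (sub_S Q))"

definition cascade :: "subsystem \<Rightarrow> subsystem \<Rightarrow> bool" where
  "cascade P1 P2 \<longleftrightarrow> decoupled_from P1 P2 \<or> decoupled_from P2 P1"

end

theory Submission
  imports Defs
begin

text \<open>If the system is not a cascade, then for each subsystem \<open>S \<noteq> 0\<close> and \<open>(J, D) \<noteq> 0\<close>. An
  observer-based controller with a static Youla parameter \<open>q\<close> stabilizes the subsystem locally for
  every real \<open>q\<close>, and its closed-loop gain from \<open>z\<^sub>j\<close> to \<open>z\<^sub>i\<close> at a real frequency \<open>\<sigma>\<close> is affine in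
  \<open>q\<close>, with slope \<open>S (\<sigma> - A - B F)\<^bsup>-1\<^esup> B\<close> times \<open>C (\<sigma> - A - L C)\<^bsup>-1\<^esup> (J + L D) + D\<close>. By
  controllability and observability the slope vanishes at only finitely many \<open>\<sigma>\<close>. So at a common
  \<open>\<sigma> > 0\<close> both local gains can be made equal to 1, and then \<open>\<sigma>\<close> is an eigenvalue of the
  overall closed loop. The feedbacks \<open>F\<close>, \<open>L\<close> are chosen such that \<open>A + B F + 1\<close> and \<open>A + L C + 1\<close> are
  nilpotent, which makes the resolvents polynomials in \<open>1 / (\<sigma> + 1)\<close>.\<close>

subsection \<open>Krylov sequences of controllable and observable pairs\<close>

text \<open>Instability is certified by one eigenvector. If each local loop, driven with amplitude 1
  at \<sigma>, answers with interconnection output 1, the two responses feed each other and together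
  form an eigenvector of the interconnection. Both loops must use the same \<sigma>. A good
  frequency for each loop separately would not do, so the exceptional sets are shown to be finite.
  Keeping \<sigma> real keeps all gains real, so one real \<open>q\<close> per loop can solve its
  affine equation. The slope is a product because \<open>q\<close> acts on the innovation alone, and
  the innovation does not depend on \<open>q\<close>: one factor leads from the external input to
  the innovation, the other from the control input to the interconnection output. The pair (J + L D,
  D) vanishes only if (J, D) does, whatever L is. Controllability and observability are hypotheses
  on trajectories; they enter only through the Krylov vectors extracted from them. For the converse,
  a cascade makes the joint state matrix block triangular, with the two local closed loops on its
  diagonal.\<close>

primrec krylov :: "'a :: semiring_0 mat \<Rightarrow> 'a vec \<Rightarrow> nat \<Rightarrow> 'a vec" where
  "krylov A b 0 = b"
| "krylov A b (Suc k) = A *\<^sub>v krylov A b k"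

lemma krylov_carrier [simp]:
  "A \<in> carrier_mat n n \<Longrightarrow> b \<in> carrier_vec n \<Longrightarrow> krylov A b k \<in> carrier_vec n"
  by (induction k) auto

lemma dim_krylov [simp]:
  "A \<in> carrier_mat n n \<Longrightarrow> b \<in> carrier_vec n \<Longrightarrow> dim_vec (krylov A b k) = n"
  by (simp only: carrier_vecD[OF krylov_carrier])

lemma krylov_krylov: "krylov A (krylov A b j) k = krylov A b (k + j)"
  by (induction k) auto

lemma krylov_Suc_right: "krylov A b (Suc k) = krylov A (A *\<^sub>v b) k"
  by (induction k) auto

lemma scalar_prod_adjoint:
  fixes A :: "'a :: comm_semiring_0 mat"
  assumes "A \<in> carrier_mat m n" "u \<in> carrier_vec m" "w \<in> carrier_vec n"
  shows "u \<bullet> (A *\<^sub>v w) = (A\<^sup>T *\<^sub>v u) \<bullet> w"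
  using transpose_vec_mult_scalar[OF assms(1,3,2)] by simp

lemma krylov_adjoint:
  fixes A :: "'a :: comm_semiring_0 mat"
  assumes "A \<in> carrier_mat n n" "u \<in> carrier_vec n" "b \<in> carrier_vec n"
  shows "u \<bullet> krylov A b k = krylov A\<^sup>T u k \<bullet> b"
  using assms(2)
proof (induction k arbitrary: u)
  case (Suc k)
  have "u \<bullet> krylov A b (Suc k) = (A\<^sup>T *\<^sub>v u) \<bullet> krylov A b k"
    using assms Suc.prems by (simp add: scalar_prod_adjoint[of A n n])
  also have "\<dots> = krylov A\<^sup>T (A\<^sup>T *\<^sub>v u) k \<bullet> b"
    using assms Suc by (intro Suc.IH) auto
  finally show ?case by (simp only: krylov_Suc_right)
qed simp

text \<open>Supplies the geometric growth behind the mean value estimate and the convergence of the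
  exponential series below. The sum of all absolute entries of A dominates every absolute row sum,
  so it can serve as the ratio.\<close>

lemma krylov_bound:
  fixes A :: "real mat"
  assumes A: "A \<in> carrier_mat n n" and b: "b \<in> carrier_vec n"
  obtains M R where "M \<ge> 0" "R \<ge> 0" "\<And>k i. i < n \<Longrightarrow> \<bar>krylov A b k $ i\<bar> \<le> M * R ^ k"
proof
  define M where "M = (\<Sum>i<n. \<bar>b $ i\<bar>)"
  define R where "R = (\<Sum>i<n. \<Sum>j<n. \<bar>A $$ (i,j)\<bar>)"
  show M0: "M \<ge> 0" and R0: "R \<ge> 0" by (auto simp: M_def R_def intro!: sum_nonneg)
  show "\<bar>krylov A b k $ i\<bar> \<le> M * R ^ k" if "i < n" for k i
    using that
  proof (induction k arbitrary: i)
    case 0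
    then show ?case using member_le_sum[of i "{..<n}" "\<lambda>i. \<bar>b $ i\<bar>"] by (simp add: M_def)
  next
    case (Suc k)
    have "krylov A b (Suc k) $ i = (\<Sum>j<n. A $$ (i,j) * krylov A b k $ j)"
      using A b Suc.prems by (simp add: scalar_prod_def lessThan_atLeast0)
    also have "\<bar>\<dots>\<bar> \<le> (\<Sum>j<n. \<bar>A $$ (i,j)\<bar> * (M * R ^ k))"
      by (rule order.trans[OF sum_abs]) (auto simp: abs_mult intro!: sum_mono mult_left_mono Suc.IH)
    also have "\<dots> = (\<Sum>j<n. \<bar>A $$ (i,j)\<bar>) * (M * R ^ k)" by (simp add: sum_distrib_right)
    also have "\<dots> \<le> R * (M * R ^ k)"
      unfolding R_def using Suc.prems M0 R0
      by (intro mult_right_mono member_le_sum[of i "{..<n}" "\<lambda>i. \<Sum>j<n. \<bar>A $$ (i,j)\<bar>"])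
         (auto intro!: sum_nonneg simp: R_def[symmetric])
    finally show ?case by (simp add: mult_ac)
  qed
qed

text \<open>Dual form of the vectors A^k b spanning the whole space: their orthogonal complement is
  trivial. Trajectory arguments deliver exactly this; the rank of n columns is recovered in
  \<open>det_krylov_mat\<close>.\<close>

definition cyclic_vec :: "real mat \<Rightarrow> real vec \<Rightarrow> bool" where
  "cyclic_vec A b \<longleftrightarrow>
     (\<forall>v\<in>carrier_vec (dim_vec b). (\<forall>k. v \<bullet> krylov A b k = 0) \<longrightarrow> v = 0\<^sub>v (dim_vec b))"

section \<open>From trajectories to Krylov vectors\<close>

lemma scalar_prod_self_eq_0:
  fixes v :: "'a :: linordered_idom vec"
  assumes "v \<in> carrier_vec n"
  shows "v \<bullet> v = 0 \<longleftrightarrow> v = 0\<^sub>v n"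
proof -
  have "v \<bullet> v = 0 \<longleftrightarrow> (\<forall>i\<in>{0..<n}. v $ i * v $ i = 0)"
    unfolding scalar_prod_def carrier_vecD[OF assms] by (rule sum_nonneg_eq_0_iff) auto
  then show ?thesis using assms by (auto simp: vec_eq_iff)
qed

lemma mult_mat_vec_1:
  fixes B :: "'a :: comm_semiring_0 mat"
  assumes "B \<in> carrier_mat n 1" "u \<in> carrier_vec 1"
  shows "B *\<^sub>v u = u $ 0 \<cdot>\<^sub>v col B 0"
  using assms by (intro eq_vecI) (auto simp: scalar_prod_def mult_ac)

lemma continuous_on_vec_bounded:
  fixes x :: "real \<Rightarrow> real vec"
  assumes "\<And>i. i < n \<Longrightarrow> continuous_on {0..T} (\<lambda>t. x t $ i)" "T \<ge> 0"
  obtains X where "X \<ge> 0" "\<And>i t. i < n \<Longrightarrow> t \<in> {0..T} \<Longrightarrow> \<bar>x t $ i\<bar> \<le> X"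
proof -
  have "\<exists>X. \<forall>t\<in>{0..T}. \<bar>x t $ i\<bar> \<le> X" if "i < n" for i
  proof -
    have "continuous_on {0..T} (\<lambda>t. \<bar>x t $ i\<bar>)"
      using assms(1)[OF that] by (rule continuous_on_rabs)
    then show ?thesis
      using continuous_attains_sup[of "{0..T}" "\<lambda>t. \<bar>x t $ i\<bar>"] assms(2) by fastforce
  qed
  then obtain X where X: "\<And>i t. i < n \<Longrightarrow> t \<in> {0..T} \<Longrightarrow> \<bar>x t $ i\<bar> \<le> X i" by metis
  show thesis
  proof
    show "0 \<le> (\<Sum>i<n. \<bar>X i\<bar>)" by (simp add: sum_nonneg)
    show "\<bar>x t $ i\<bar> \<le> (\<Sum>i<n. \<bar>X i\<bar>)" if "i < n" "t \<in> {0..T}" for i t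
    proof -
      have "\<bar>x t $ i\<bar> \<le> \<bar>X i\<bar>" using X[OF that] by linarith
      also have "\<dots> \<le> (\<Sum>i<n. \<bar>X i\<bar>)" using that by (intro member_le_sum) auto
      finally show ?thesis .
    qed
  qed
qed

text \<open>Here \<open>f k\<close> is the k-th derivative of \<open>f 0\<close>. Each use of the
  mean value theorem passes to the next derivative at the price of a factor at most T, while the
  bound grows by R. After m uses the estimate is K (T R)^m, which tends to 0.\<close>

lemma iterated_derivatives_eq_0:
  fixes f :: "nat \<Rightarrow> real \<Rightarrow> real"
  assumes T: "T > 0" "T * R < 1" and R: "R \<ge> 0"
    and deriv: "\<And>k t. t \<in> {0..T} \<Longrightarrow> (f k has_real_derivative f (Suc k) t) (at t within {0..T})"
    and zero: "\<And>k. f k 0 = 0"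
    and bound: "\<And>k t. t \<in> {0..T} \<Longrightarrow> \<bar>f k t\<bar> \<le> K * R ^ k"
    and t: "t \<in> {0..T}"
  shows "f 0 t = 0"
proof -
  have "\<bar>f k t\<bar> \<le> (T * R) ^ m * (K * R ^ k)" if "t \<in> {0..T}" for k m t
    using that
  proof (induction m arbitrary: k t)
    case (Suc m)
    show ?case
    proof (cases "t = 0")
      case True
      have "0 \<le> K * R ^ k" using bound[of 0 k] T by auto
      then show ?thesis using True zero T R by simp
    next
      case False
      with Suc.prems have t0: "0 < t" "t \<le> T" by auto
      have "continuous_on {0..T} (f k)"
        using deriv by (rule DERIV_continuous_on)
      then have "continuous_on {0..t} (f k)"
        by (rule continuous_on_subset) (use t0 in auto)
      moreover have "(f k has_derivative (*) (f (Suc k) x)) (at x)" if "0 < x" "x < t" for x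
        using deriv[of x k] that t0 by (simp add: at_within_Icc_at has_field_derivative_def)
      ultimately obtain z where "0 < z" "z < t" "f k t - f k 0 = f (Suc k) z * (t - 0)"
        using mvt[OF t0(1), of "f k" "\<lambda>x. (*) (f (Suc k) x)"] by blast
      then have z: "0 < z" "z < t" "f k t = t * f (Suc k) z" using zero by auto
      have "\<bar>f k t\<bar> \<le> T * ((T * R) ^ m * (K * R ^ Suc k))"
        using z t0 Suc.IH[of z "Suc k"] unfolding z(3) abs_mult by (intro mult_mono) auto
      then show ?thesis by (simp add: mult_ac)
    qed
  next
    case 0
    then show ?case using bound by simp
  qed
  note * = this[OF t, of 0]
  have "(\<lambda>m. (T * R) ^ m * (K * R ^ 0)) \<longlonglongrightarrow> 0"
    using T R by (auto intro!: tendsto_mult_left_zero LIMSEQ_power_zero)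
  then have "\<bar>f 0 t\<bar> \<le> 0" using * by (intro LIMSEQ_le_const) auto
  then show ?thesis by simp
qed

text \<open>If v is orthogonal to all A^k b, put w_k = (A^T)^k v. The input drops out of the
  derivative of w_k . x, which is therefore w_(k+1) . x, so merely continuous inputs cause no
  trouble. Starting at 0 all these quantities stay 0, and steering to v itself gives v . v =
  0.\<close>

lemma controllable_imp_cyclic:
  assumes A: "A \<in> carrier_mat n n" and B: "B \<in> carrier_mat n 1" and ctrl: "controllable A B"
  shows "cyclic_vec A (col B 0)"
proof -
  define b where "b = col B 0"
  have b: "b \<in> carrier_vec n" using B by (auto simp: b_def)
  have "v = 0\<^sub>v n" if v: "v \<in> carrier_vec n" and orth: "\<And>k. v \<bullet> krylov A b k = 0" for v
  proof -
    define w where "w = krylov A\<^sup>T v"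
    have w: "w k \<in> carrier_vec n" for k using A v by (simp add: w_def)
    have wb: "w k \<bullet> b = 0" for k using krylov_adjoint[OF A v b] orth by (simp add: w_def)
    obtain M R where M: "M \<ge> 0" and R: "R \<ge> 0" and wbound: "\<And>k i. i < n \<Longrightarrow> \<bar>w k $ i\<bar> \<le> M * R ^ k"
      unfolding w_def using A v by (auto intro: krylov_bound[of "A\<^sup>T" n v])
    \<comment> \<open>Controllability is available for every positive time, so T can be taken short
      enough for T R < 1.\<close>
    define T where "T = 1 / (R + 1)"
    have T: "T > 0" "T * R < 1" using R by (auto simp: T_def field_simps)
    obtain u x where u: "\<And>t. t \<in> {0..T} \<Longrightarrow> u t \<in> carrier_vec 1"
      and sol: "solves A (\<lambda>t. B *\<^sub>v u t) T x" and x0: "x 0 = 0\<^sub>v n" and xT: "x T = v"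
      using ctrl T(1) A B v unfolding controllable_def by (metis carrier_matD zero_carrier_vec)
    have xc: "x t \<in> carrier_vec n" if "t \<in> {0..T}" for t
      using sol A that by (auto simp: solves_def)
    have xd: "((\<lambda>s. x s $ i) has_real_derivative (A *\<^sub>v x t + B *\<^sub>v u t) $ i) (at t within {0..T})"
      if "t \<in> {0..T}" "i < n" for t i
      using sol A that by (auto simp: solves_def)
    have cont: "continuous_on {0..T} (\<lambda>t. x t $ i)" if "i < n" for i
      using xd[OF _ that] by (rule DERIV_continuous_on)
    obtain X where X: "X \<ge> 0" "\<And>i t. i < n \<Longrightarrow> t \<in> {0..T} \<Longrightarrow> \<bar>x t $ i\<bar> \<le> X"
      using continuous_on_vec_bounded[OF cont less_imp_le[OF T(1)]] by blast
    define f where "f k t = (\<Sum>i<n. w k $ i * x t $ i)" for k t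
    have f_eq: "f k t = w k \<bullet> x t" if "t \<in> {0..T}" for k t
      using xc[OF that] by (simp add: f_def scalar_prod_def lessThan_atLeast0)
    have "f 0 T = 0"
    proof (rule iterated_derivatives_eq_0[where f = f and T = T and R = R and K = "n * M * X"])
      fix k t assume t: "t \<in> {0..T}"
      have "(f k has_real_derivative (\<Sum>i<n. w k $ i * (A *\<^sub>v x t + B *\<^sub>v u t) $ i)) (at t within {0..T})"
        unfolding f_def by (intro DERIV_sum DERIV_cmult xd[OF t]) simp
      also have "(\<Sum>i<n. w k $ i * (A *\<^sub>v x t + B *\<^sub>v u t) $ i) = w k \<bullet> (A *\<^sub>v x t + B *\<^sub>v u t)"
        using B by (simp only: scalar_prod_def index_add_vec dim_mult_mat_vec carrier_matD lessThan_atLeast0)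
      also have "\<dots> = w k \<bullet> (A *\<^sub>v x t) + w k \<bullet> (B *\<^sub>v u t)"
        using A B w u[OF t] xc[OF t] by (intro scalar_prod_add_distrib) auto
      also have "w k \<bullet> (B *\<^sub>v u t) = 0"
        using wb[of k] w[of k] b B u[OF t] by (simp add: mult_mat_vec_1 b_def)
      also have "w k \<bullet> (A *\<^sub>v x t) = w (Suc k) \<bullet> x t"
        using A w xc[OF t] by (simp add: scalar_prod_adjoint[of A n n] w_def)
      finally show "(f k has_real_derivative f (Suc k) t) (at t within {0..T})"
        by (simp add: f_eq[OF t])
      have "\<bar>f k t\<bar> \<le> (\<Sum>i<n. \<bar>w k $ i * x t $ i\<bar>)"
        unfolding f_def by (rule sum_abs)
      also have "\<dots> \<le> (\<Sum>i<n. (M * R ^ k) * X)"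
        unfolding abs_mult using M R X t by (intro sum_mono mult_mono wbound) auto
      finally have "\<bar>f k t\<bar> \<le> (\<Sum>i<n. (M * R ^ k) * X)" .
      then show "\<bar>f k t\<bar> \<le> (n * M * X) * R ^ k" by (simp add: mult_ac)
    next
      show "f k 0 = 0" for k by (simp add: f_def x0)
    qed (use T R in auto)
    then have "v \<bullet> v = 0" using f_eq[of T 0] T xT by (simp add: w_def)
    then show ?thesis using v by (simp add: scalar_prod_self_eq_0)
  qed
  then show ?thesis
    unfolding cyclic_vec_def b_def[symmetric] carrier_vecD[OF b] by blast
qed

text \<open>The trajectory exp(t A) x is written entrywise as a power series. If x is orthogonal to
  all (A^T)^k c, every coefficient of its output vanishes, so it cannot be told apart from the zero
  trajectory.\<close>

lemma observable_imp_cyclic: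
  assumes A: "A \<in> carrier_mat n n" and C: "C \<in> carrier_mat 1 n" and obs: "observable A C"
  shows "cyclic_vec A\<^sup>T (row C 0)"
proof -
  define c where "c = row C 0"
  have c: "c \<in> carrier_vec n" using C by (auto simp: c_def)
  have "x = 0\<^sub>v n" if x: "x \<in> carrier_vec n" and orth: "\<And>k. x \<bullet> krylov A\<^sup>T c k = 0" for x
  proof -
    have orth': "c \<bullet> krylov A x k = 0" for k
      using krylov_adjoint[OF _ x c, of "A\<^sup>T" k] orth[of k] A c x
      by (metis comm_scalar_prod krylov_carrier transpose_carrier_mat transpose_transpose)
    define a where "a i k = krylov A x k $ i / fact k" for i k
    define X where "X t = vec n (\<lambda>i. \<Sum>k. a i k * t ^ k)" for t
    obtain M R where M: "M \<ge> 0" and R: "R \<ge> 0" and bound: "\<And>k i. i < n \<Longrightarrow> \<bar>krylov A x k $ i\<bar> \<le> M * R ^ k"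
      using krylov_bound[OF A x] by metis
    have summable: "summable (\<lambda>k. a i k * t ^ k)" if "i < n" for i t
    proof (rule summable_comparison_test')
      show "summable (\<lambda>k. M * (inverse (fact k) * (R * \<bar>t\<bar>) ^ k))"
        by (intro summable_mult summable_exp)
      show "norm (a i k * t ^ k) \<le> M * (inverse (fact k) * (R * \<bar>t\<bar>) ^ k)" if "k \<ge> 0" for k
        using mult_right_mono[OF bound[OF \<open>i < n\<close>, of k], of "\<bar>t\<bar> ^ k / fact k"]
        by (simp add: a_def abs_mult power_abs power_mult_distrib field_simps)
    qed
    have X: "X t \<in> carrier_vec n" for t by (simp add: X_def)
    \<comment> \<open>Used with y a row of A to verify the differential equation, and with y = c to
      compute the output.\<close>
    have prod_X: "y \<bullet> X t = (\<Sum>k. (y \<bullet> krylov A x k) / fact k * t ^ k)" if "y \<in> carrier_vec n" for y t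
    proof -
      have "y \<bullet> X t = (\<Sum>i<n. y $ i * (\<Sum>k. a i k * t ^ k))"
        by (simp add: scalar_prod_def X_def lessThan_atLeast0)
      also have "\<dots> = (\<Sum>i<n. \<Sum>k. y $ i * (a i k * t ^ k))"
        using summable by (intro sum.cong) (auto simp: suminf_mult)
      also have "\<dots> = (\<Sum>k. \<Sum>i<n. y $ i * (a i k * t ^ k))"
        using summable by (intro suminf_sum[symmetric]) (auto intro: summable_mult)
      also have "\<dots> = (\<Sum>k. (y \<bullet> krylov A x k) / fact k * t ^ k)"
        using A x by (intro arg_cong[of _ _ suminf] ext)
           (simp add: scalar_prod_def a_def lessThan_atLeast0 sum_divide_distrib sum_distrib_left sum_distrib_right mult_ac)
      finally show ?thesis .
    qed
    have "solves A (\<lambda>_. 0\<^sub>v (dim_row A)) 1 X"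
      unfolding solves_def
    proof (intro conjI ballI allI impI)
      fix t :: real and i assume i: "i < dim_row A"
      then have "i < n" using A by simp
      have "((\<lambda>t. \<Sum>k. a i k * t ^ k) has_real_derivative (\<Sum>k. diffs (a i) k * t ^ k)) (at t)"
        by (rule termdiffs_strong_converges_everywhere) (rule summable[OF \<open>i < n\<close>])
      also have "(\<Sum>k. diffs (a i) k * t ^ k) = (\<Sum>k. (row A i \<bullet> krylov A x k) / fact k * t ^ k)"
        using i by (simp add: diffs_def a_def del: of_nat_Suc)
      also have "\<dots> = row A i \<bullet> X t" using A i by (simp add: prod_X)
      finally show "((\<lambda>s. X s $ i) has_real_derivative (A *\<^sub>v X t + 0\<^sub>v (dim_row A)) $ i) (at t within {0..1})"
        using i \<open>i < n\<close> by (simp add: X_def has_field_derivative_at_within)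
    qed (use X A in auto)
    moreover have "solves A (\<lambda>_. 0\<^sub>v (dim_row A)) 1 (\<lambda>_. 0\<^sub>v n)"
      using A by (auto simp: solves_def)
    moreover have "C *\<^sub>v X t = C *\<^sub>v 0\<^sub>v n" for t
      using C prod_X[OF c] orth' by (intro eq_vecI) (auto simp: c_def)
    ultimately have "X 0 = 0\<^sub>v n"
      using obs[unfolded observable_def, rule_format, of 1 X "\<lambda>_. 0\<^sub>v n"] by simp
    moreover have "X 0 = x" using x by (intro eq_vecI) (auto simp: X_def powser_zero, simp add: a_def)
    ultimately show ?thesis by simp
  qed
  then show ?thesis
    unfolding cyclic_vec_def c_def[symmetric] carrier_vecD[OF c] by blast
qed

subsection \<open>Deadbeat state feedback\<close>

lemma det_nonzero_solve:
  fixes M :: "'a :: field mat"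
  assumes M: "M \<in> carrier_mat n n" and det: "det M \<noteq> 0" and y: "y \<in> carrier_vec n"
  obtains x where "x \<in> carrier_vec n" "M *\<^sub>v x = y"
proof -
  obtain Q where Q: "Q \<in> carrier_mat n n" "M * Q = 1\<^sub>m n"
    using det_non_zero_imp_unit[OF M det, of "()"] by (auto simp: Units_def ring_mat_def)
  have "M *\<^sub>v (Q *\<^sub>v y) = (M * Q) *\<^sub>v y" using M Q(1) y by simp
  also have "\<dots> = y" using Q(2) y by simp
  finally have "M *\<^sub>v (Q *\<^sub>v y) = y" .
  moreover have "Q *\<^sub>v y \<in> carrier_vec n" using Q(1) y by simp
  ultimately show thesis using that by blast
qed

text \<open>Kalman's controllability matrix.\<close>

definition krylov_mat :: "'a :: semiring_0 mat \<Rightarrow> 'a vec \<Rightarrow> nat \<Rightarrow> 'a mat" where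
  "krylov_mat A b n = mat n n (\<lambda>(i,k). krylov A b k $ i)"

lemma krylov_mat_carrier [simp]: "krylov_mat A b n \<in> carrier_mat n n"
  by (simp add: krylov_mat_def)

lemma scalar_prod_krylov_mat:
  fixes A :: "'a :: comm_semiring_0 mat"
  assumes "A \<in> carrier_mat n n" "b \<in> carrier_vec n" "u \<in> carrier_vec n" "c \<in> carrier_vec n"
  shows "u \<bullet> (krylov_mat A b n *\<^sub>v c) = (\<Sum>k<n. c $ k * (u \<bullet> krylov A b k))"
proof -
  have "u \<bullet> (krylov_mat A b n *\<^sub>v c) = (\<Sum>i<n. \<Sum>k<n. u $ i * (krylov A b k $ i * c $ k))"
    using assms by (simp add: scalar_prod_def krylov_mat_def lessThan_atLeast0 sum_distrib_left)
  also have "\<dots> = (\<Sum>k<n. \<Sum>i<n. u $ i * (krylov A b k $ i * c $ k))"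
    by (rule sum.swap)
  also have "\<dots> = (\<Sum>k<n. c $ k * (u \<bullet> krylov A b k))"
    using assms by (simp add: scalar_prod_def lessThan_atLeast0 sum_distrib_left mult_ac)
  finally show ?thesis .
qed

lemma mult_mat_vec_0 [simp]: "A \<in> carrier_mat m n \<Longrightarrow> A *\<^sub>v 0\<^sub>v n = 0\<^sub>v m"
  by (intro eq_vecI) auto

lemma last_nonzero_coordinate:
  fixes c :: "'a :: zero vec"
  assumes "c \<in> carrier_vec n" "c \<noteq> 0\<^sub>v n"
  obtains m where "m < n" "c $ m \<noteq> 0" "\<And>k. m < k \<Longrightarrow> k < n \<Longrightarrow> c $ k = 0"
proof -
  define S where "S = {k. k < n \<and> c $ k \<noteq> 0}"
  have S: "finite S" "S \<noteq> {}" using assms by (auto simp: S_def vec_eq_iff)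
  have "c $ k = 0" if "Max S < k" "k < n" for k
  proof (rule ccontr)
    assume "c $ k \<noteq> 0"
    then have "k \<in> S" using that by (simp add: S_def)
    then show False using Max_ge[OF S(1), of k] that by simp
  qed
  moreover have "Max S < n" "c $ Max S \<noteq> 0" using Max_in[OF S] by (auto simp: S_def)
  ultimately show thesis using that by blast
qed

lemma vec_eq_0_if_orthogonal:
  fixes x :: "'a :: linordered_idom vec"
  assumes "x \<in> carrier_vec n" "\<And>u. u \<in> carrier_vec n \<Longrightarrow> u \<bullet> x = 0"
  shows "x = 0\<^sub>v n"
  using assms scalar_prod_self_eq_0[of x n] by simp

lemma cyclic_vecD:
  assumes "cyclic_vec A b" "b \<in> carrier_vec n" "v \<in> carrier_vec n" "\<And>k. v \<bullet> krylov A b k = 0"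
  shows "v = 0\<^sub>v n"
  using assms by (simp add: cyclic_vec_def)

text \<open>A linear relation among the first \<open>n\<close> vectors \<open>A\<^sup>k b\<close> makes all later ones combinations of
  fewer than \<open>n\<close> of them, which replaces the Cayley--Hamilton theorem.\<close>

lemma det_krylov_mat:
  assumes A: "A \<in> carrier_mat n n" and b: "b \<in> carrier_vec n" and cyc: "cyclic_vec A b"
  shows "det (krylov_mat A b n) \<noteq> 0"
proof
  assume det0: "det (krylov_mat A b n) = 0"
  then have "det (krylov_mat A b n)\<^sup>T = 0" by (simp add: det_transpose[OF krylov_mat_carrier])
  \<comment> \<open>A left null vector u is orthogonal to the first n Krylov vectors; the right null
    vector c obtained next is a linear relation among them.\<close>
  then obtain u where u: "u \<in> carrier_vec n" "u \<noteq> 0\<^sub>v n" "(krylov_mat A b n)\<^sup>T *\<^sub>v u = 0\<^sub>v n"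
    using det_0_iff_vec_prod_zero[of "(krylov_mat A b n)\<^sup>T" n] by auto
  obtain c where c: "c \<in> carrier_vec n" "c \<noteq> 0\<^sub>v n" "krylov_mat A b n *\<^sub>v c = 0\<^sub>v n"
    using det_0_iff_vec_prod_zero[of "krylov_mat A b n" n] det0 by auto
  define g where "g k = u \<bullet> krylov A b k" for k
  have g0: "g k = 0" if "k < n" for k
  proof -
    have "col (krylov_mat A b n) k \<bullet> u = 0"
      using arg_cong[OF u(3), of "\<lambda>v. v $ k"] that by (simp add: krylov_mat_def)
    moreover have "col (krylov_mat A b n) k = krylov A b k"
      using A b that by (intro eq_vecI) (auto simp: krylov_mat_def)
    ultimately show ?thesis
      using A b u(1) comm_scalar_prod[of "krylov A b k" n u] by (simp add: g_def)
  qed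
  have rel: "(\<Sum>k<n. c $ k * g (d + k)) = 0" for d
  proof -
    define w where "w = krylov A\<^sup>T u d"
    have w: "w \<in> carrier_vec n" using A u(1) by (simp add: w_def)
    have "g (d + k) = w \<bullet> krylov A b k" for k
      using krylov_adjoint[OF A u(1), of "krylov A b k" d] A b
      by (simp add: g_def w_def krylov_krylov)
    then show ?thesis
      using scalar_prod_krylov_mat[OF A b w c(1)] c(3) w by simp
  qed
  \<comment> \<open>Multiplied by A^d with d = j - m, the relation has A^j b as its highest term
    with nonzero coefficient. So \<open>g j\<close> is a combination of earlier values of
    \<open>g\<close>, which vanish by induction.\<close>
  obtain m where m: "m < n" "c $ m \<noteq> 0" and m_max: "\<And>k. m < k \<Longrightarrow> k < n \<Longrightarrow> c $ k = 0"
    using last_nonzero_coordinate[OF c(1,2)] by blast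
  have "g j = 0" for j
  proof (induction j rule: less_induct)
    case (less j)
    show ?case
    proof (cases "j < n")
      case False
      define d where "d = j - m"
      have j: "j = d + m" using False m by (simp add: d_def)
      have "(\<Sum>k<n. c $ k * g (d + k)) = (\<Sum>k\<in>{m}. c $ k * g (d + k))"
      proof (rule sum.mono_neutral_right)
        show "\<forall>k\<in>{..<n} - {m}. c $ k * g (d + k) = 0"
        proof
          fix k assume "k \<in> {..<n} - {m}"
          then show "c $ k * g (d + k) = 0"
            using m_max[of k] less.IH[of "d + k"] j by (cases "k < m") auto
        qed
      qed (use m in auto)
      then show ?thesis using rel[of d] m j by simp
    qed (use g0 in simp)
  qed
  then have "u = 0\<^sub>v n" using cyclic_vecD[OF cyc b u(1)] by (simp add: g_def)
  then show False using u(2) by simp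
qed

text \<open>A and A + 1 generate the same Krylov space. The induction on j, for all k at once,
  replaces a factor A by (A + 1) - 1 and moves A + 1 to the side of v.\<close>

lemma cyclic_vec_shift:
  assumes A: "A \<in> carrier_mat n n" and b: "b \<in> carrier_vec n" and cyc: "cyclic_vec A b"
  shows "cyclic_vec (A + 1\<^sub>m n) b"
proof -
  define A' where "A' = A + 1\<^sub>m n"
  have A': "A' \<in> carrier_mat n n" using A by (simp add: A'_def)
  have "v = 0\<^sub>v n" if v: "v \<in> carrier_vec n" and orth: "\<And>k. v \<bullet> krylov A' b k = 0" for v
  proof -
    have orthA: "krylov A'\<^sup>T v k \<bullet> krylov A b j = 0" for k j
    proof (induction j arbitrary: k)
      case 0
      then show ?case using krylov_adjoint[OF A' v b, of k] orth by simp
    next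
      case (Suc j)
      define w x where "w = krylov A'\<^sup>T v k" and "x = krylov A b j"
      have w: "w \<in> carrier_vec n" and x: "x \<in> carrier_vec n"
        using A A' b v by (simp_all add: w_def x_def)
      have "w \<bullet> (A' *\<^sub>v x) = (A'\<^sup>T *\<^sub>v w) \<bullet> x"
        using A' w x by (rule scalar_prod_adjoint)
      also have "\<dots> = 0" using Suc[of "Suc k"] by (simp add: w_def x_def)
      finally have "w \<bullet> (A' *\<^sub>v x) = 0" .
      moreover have "A' *\<^sub>v x = A *\<^sub>v x + x"
        using A x by (simp add: A'_def add_mult_distrib_mat_vec[of _ n n])
      moreover have "w \<bullet> (A *\<^sub>v x + x) = w \<bullet> (A *\<^sub>v x) + w \<bullet> x"
        using A w x by (intro scalar_prod_add_distrib) auto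
      moreover have "w \<bullet> x = 0" using Suc[of k] by (simp add: w_def x_def)
      ultimately show ?case by (simp add: w_def x_def)
    qed
    have "v \<bullet> krylov A b k = 0" for k using orthA[of 0 k] by simp
    then show ?thesis using cyclic_vecD[OF cyc b v] by blast
  qed
  then show ?thesis
    unfolding cyclic_vec_def A'_def[symmetric] carrier_vecD[OF b] by blast
qed

section \<open>Nilpotency by state feedback\<close>

definition nilpotent_mat :: "real mat \<Rightarrow> bool" where
  "nilpotent_mat N \<longleftrightarrow> (\<forall>w\<in>carrier_vec (dim_row N). krylov N w (dim_row N) = 0\<^sub>v (dim_row N))"

lemma nilpotent_matD:
  "nilpotent_mat N \<Longrightarrow> N \<in> carrier_mat n n \<Longrightarrow> w \<in> carrier_vec n \<Longrightarrow> krylov N w n = 0\<^sub>v n"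
  by (simp add: nilpotent_mat_def)

lemma nilpotent_mat_transpose:
  assumes N: "N \<in> carrier_mat n n" and nil: "nilpotent_mat N"
  shows "nilpotent_mat N\<^sup>T"
proof -
  have "krylov N\<^sup>T w n = 0\<^sub>v n" if w: "w \<in> carrier_vec n" for w
  proof (rule vec_eq_0_if_orthogonal)
    fix u :: "real vec" assume u: "u \<in> carrier_vec n"
    have "u \<bullet> krylov N\<^sup>T w n = krylov N u n \<bullet> w"
      using krylov_adjoint[of "N\<^sup>T" n u w n] N u w by simp
    then show "u \<bullet> krylov N\<^sup>T w n = 0"
      using nilpotent_matD[OF nil N u] w by simp
  qed (use N w in simp)
  then show ?thesis using N by (simp add: nilpotent_mat_def)
qed

text \<open>Ackermann's choice of feedback: with \<open>v\<close> dual to \<open>A\<^bsup>n-1\<^esup> b\<close>, adding \<open>b f\<^sup>T\<close> for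
  \<open>f\<^sup>T = - v\<^sup>T A\<^sup>n\<close> leaves \<open>v\<^sup>T A\<^sup>k\<close> unchanged for \<open>k < n\<close> and turns \<open>v\<^sup>T A\<^sup>n\<close> into \<open>0\<close>.\<close>

lemma nilpotent_feedback:
  assumes A: "A \<in> carrier_mat n n" and B: "B \<in> carrier_mat n 1" and n: "n > 0"
    and cyc: "cyclic_vec A (col B 0)"
  obtains F where "F \<in> carrier_mat 1 n" "nilpotent_mat (A + B * F)" "cyclic_vec (A + B * F) (col B 0)"
proof -
  define b where "b = col B 0"
  have b: "b \<in> carrier_vec n" using B by (auto simp: b_def)
  define Kr where "Kr = krylov_mat A b n"
  have Kr: "Kr \<in> carrier_mat n n" by (simp add: Kr_def)
  have det: "det Kr \<noteq> 0" unfolding Kr_def using A b cyc by (intro det_krylov_mat) (simp_all add: b_def)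
  have "det Kr\<^sup>T \<noteq> 0" using det det_transpose[OF Kr] by simp
  \<comment> \<open>v is the last row of the inverse of the controllability matrix.\<close>
  then obtain v where v: "v \<in> carrier_vec n" and Kv: "Kr\<^sup>T *\<^sub>v v = unit_vec n (n - 1)"
    using det_nonzero_solve[of "Kr\<^sup>T" n "unit_vec n (n - 1)"] Kr by auto
  have vb: "v \<bullet> krylov A b k = (if k = n - 1 then 1 else 0)" if "k < n" for k
  proof -
    have "col Kr k \<bullet> v = (if k = n - 1 then 1 else 0)"
      using arg_cong[OF Kv, of "\<lambda>v. v $ k"] that Kr n by (simp add: unit_vec_def)
    moreover have "col Kr k = krylov A b k"
      using A b that by (intro eq_vecI) (auto simp: Kr_def krylov_mat_def)
    ultimately show ?thesis
      using A b v comm_scalar_prod[of "krylov A b k" n v] by simp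
  qed
  define F where "F = mat 1 n (\<lambda>(i,j). - krylov A\<^sup>T v n $ j)"
  have F: "F \<in> carrier_mat 1 n" by (simp add: F_def)
  define N where "N = A + B * F"
  have N: "N \<in> carrier_mat n n" using A B F by (simp add: N_def)
  \<comment> \<open>The feedback changes the transposed action on u only by a multiple u . b of one
    fixed vector, hence not at all when u is orthogonal to b.\<close>
  have NT: "N\<^sup>T *\<^sub>v u = A\<^sup>T *\<^sub>v u - (u \<bullet> b) \<cdot>\<^sub>v krylov A\<^sup>T v n" if u: "u \<in> carrier_vec n" for u
  proof (rule eq_vecI)
    fix i assume "i < dim_vec (A\<^sup>T *\<^sub>v u - (u \<bullet> b) \<cdot>\<^sub>v krylov A\<^sup>T v n)"
    then have i: "i < n" using A v by simp
    have "(N\<^sup>T *\<^sub>v u) $ i = col N i \<bullet> u" using N i by simp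
    also have "col N i = col A i - krylov A\<^sup>T v n $ i \<cdot>\<^sub>v b"
      using A B F i by (intro eq_vecI) (auto simp: N_def F_def b_def scalar_prod_def)
    also have "\<dots> \<bullet> u = col A i \<bullet> u - (krylov A\<^sup>T v n $ i \<cdot>\<^sub>v b) \<bullet> u"
      using A b u i by (intro minus_scalar_prod_distrib) auto
    also have "(krylov A\<^sup>T v n $ i \<cdot>\<^sub>v b) \<bullet> u = krylov A\<^sup>T v n $ i * (u \<bullet> b)"
      using b u comm_scalar_prod[OF b u] by simp
    finally show "(N\<^sup>T *\<^sub>v u) $ i = (A\<^sup>T *\<^sub>v u - (u \<bullet> b) \<cdot>\<^sub>v krylov A\<^sup>T v n) $ i"
      using A i v u by (simp add: mult.commute)
  qed (use A N v in simp)
  have vN: "krylov N\<^sup>T v k = krylov A\<^sup>T v k" if "k < n" for k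
    using that
  proof (induction k)
    case (Suc k)
    define w where "w = krylov A\<^sup>T v k"
    have w: "w \<in> carrier_vec n" using A v by (simp add: w_def)
    have "w \<bullet> b = 0" using vb[of k] krylov_adjoint[OF A v b, of k] Suc.prems by (simp add: w_def)
    then have "N\<^sup>T *\<^sub>v w = A\<^sup>T *\<^sub>v w"
      unfolding NT[OF w] using A v w by (intro eq_vecI) auto
    then show ?case using Suc by (simp add: w_def)
  qed simp
  have vN_n: "krylov N\<^sup>T v n = 0\<^sub>v n"
  proof -
    define w where "w = krylov A\<^sup>T v (n - 1)"
    have w: "w \<in> carrier_vec n" using A v by (simp add: w_def)
    have Aw: "A\<^sup>T *\<^sub>v w = krylov A\<^sup>T v n"
      using n by (cases n) (simp_all add: w_def)
    have "w \<bullet> b = 1" using vb[of "n - 1"] krylov_adjoint[OF A v b, of "n - 1"] n by (simp add: w_def)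
    then have "N\<^sup>T *\<^sub>v w = 0\<^sub>v n"
      unfolding NT[OF w] Aw using A v by (intro eq_vecI) auto
    moreover have "krylov N\<^sup>T v n = N\<^sup>T *\<^sub>v w"
      using n vN[of "n - 1"] by (cases n) (simp_all add: w_def)
    ultimately show ?thesis by simp
  qed
  \<comment> \<open>The vectors (A^T)^k v with k < n separate points: by \<open>vb\<close>, their
    products with the columns of \<open>Kr\<close> form an anti-triangular matrix with ones on the
    antidiagonal.\<close>
  have indep: "w = 0\<^sub>v n" if w: "w \<in> carrier_vec n" and orth: "\<And>k. k < n \<Longrightarrow> krylov A\<^sup>T v k \<bullet> w = 0" for w
  proof -
    obtain c where c: "c \<in> carrier_vec n" "Kr *\<^sub>v c = w"
      using det_nonzero_solve[OF Kr det w] by blast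
    have "c = 0\<^sub>v n"
    proof (rule ccontr)
      assume "c \<noteq> 0\<^sub>v n"
      then obtain m where m: "m < n" "c $ m \<noteq> 0"
        and m_max: "\<And>k. m < k \<Longrightarrow> k < n \<Longrightarrow> c $ k = 0"
        using last_nonzero_coordinate[OF c(1)] by blast
      \<comment> \<open>For this d the terms with k < m have d + k < n - 1 and vanish by
        \<open>vb\<close>, those with k > m have coefficient 0, and \<open>c $ m\<close> alone
        survives.\<close>
      define d where "d = n - 1 - m"
      have vd: "krylov A\<^sup>T v d \<in> carrier_vec n" using A v by simp
      have *: "krylov A\<^sup>T v d \<bullet> krylov A b k = v \<bullet> krylov A b (d + k)" for k
        using krylov_adjoint[OF A v, of "krylov A b k" d] A b by (simp add: krylov_krylov)
      have "krylov A\<^sup>T v d \<bullet> w = (\<Sum>k<n. c $ k * (v \<bullet> krylov A b (d + k)))"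
        using scalar_prod_krylov_mat[OF A b vd c(1)] c(2) by (simp add: * Kr_def)
      also have "\<dots> = (\<Sum>k\<in>{m}. c $ k * (v \<bullet> krylov A b (d + k)))"
      proof (rule sum.mono_neutral_right)
        show "\<forall>k\<in>{..<n} - {m}. c $ k * (v \<bullet> krylov A b (d + k)) = 0"
        proof
          fix k assume "k \<in> {..<n} - {m}"
          then show "c $ k * (v \<bullet> krylov A b (d + k)) = 0"
            using m_max[of k] vb[of "d + k"] m(1) by (cases "k < m") (auto simp: d_def)
        qed
      qed (use m in auto)
      also have "\<dots> = c $ m" using vb[of "d + m"] m n by (simp add: d_def)
      finally show False using orth[of d] m n by (simp add: d_def)
    qed
    then show ?thesis using c Kr by simp
  qed
  have vN_ge: "krylov N\<^sup>T v (n + k) = 0\<^sub>v n" for k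
  proof -
    have "krylov N\<^sup>T (0\<^sub>v n) k = 0\<^sub>v n" using N by (induction k) auto
    then show ?thesis using vN_n krylov_krylov[of "N\<^sup>T" v n k] by (simp add: add.commute)
  qed
  have "nilpotent_mat N"
    unfolding nilpotent_mat_def carrier_matD(1)[OF N]
  proof
    fix w :: "real vec" assume w: "w \<in> carrier_vec n"
    \<comment> \<open>Tested against (A^T)^k v = (N^T)^k v, the vector N^n w gives v^T N^(n+k) w,
      and v^T N^n = 0.\<close>
    show "krylov N w n = 0\<^sub>v n"
    proof (rule indep)
      fix k assume k: "k < n"
      have "krylov A\<^sup>T v k \<bullet> krylov N w n = krylov N\<^sup>T (krylov N\<^sup>T v k) n \<bullet> w"
        unfolding vN[OF k, symmetric] using N v w by (intro krylov_adjoint) auto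
      also have "\<dots> = 0" using vN_ge[of k] w by (simp add: krylov_krylov)
      finally show "krylov A\<^sup>T v k \<bullet> krylov N w n = 0" .
    qed (use N w in simp)
  qed
  moreover have "cyclic_vec N b"
  proof -
    \<comment> \<open>State feedback preserves cyclicity: for u orthogonal to all N^k b the
      correction in \<open>NT\<close> never acts, so u is orthogonal to all A^k b as well.\<close>
    have "u = 0\<^sub>v n" if u: "u \<in> carrier_vec n" and orth: "\<And>k. u \<bullet> krylov N b k = 0" for u
    proof -
      have uN: "krylov N\<^sup>T u k \<bullet> b = 0" for k using orth[of k] krylov_adjoint[OF N u b, of k] by simp
      have eq: "krylov N\<^sup>T u k = krylov A\<^sup>T u k" for k
      proof (induction k)
        case (Suc k)
        define w where "w = krylov N\<^sup>T u k"
        have w: "w \<in> carrier_vec n" using N u by (simp add: w_def)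
        have "w \<bullet> b = 0" using uN[of k] by (simp add: w_def)
        then have "N\<^sup>T *\<^sub>v w = A\<^sup>T *\<^sub>v w"
          unfolding NT[OF w] using A v w by (intro eq_vecI) auto
        then show ?case using Suc by (simp add: w_def)
      qed simp
      have "u \<bullet> krylov A b k = 0" for k
        using krylov_adjoint[OF A u b, of k] uN[of k] eq by simp
      then show ?thesis using cyclic_vecD[OF _ b u, of A] cyc by (simp add: b_def)
    qed
    then show ?thesis unfolding cyclic_vec_def carrier_vecD[OF b] by blast
  qed
  ultimately show thesis using that F by (simp add: N_def b_def)
qed

subsection \<open>Resolvents of nilpotent matrices\<close>

lemma pow_mat_mult_vec:
  fixes A :: "'a :: comm_semiring_1 mat"
  assumes "A \<in> carrier_mat n n" "w \<in> carrier_vec n"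
  shows "A ^\<^sub>m k *\<^sub>v w = krylov A w k"
  using assms(2)
proof (induction k arbitrary: w)
  case (Suc k)
  have "A ^\<^sub>m Suc k *\<^sub>v w = A ^\<^sub>m k *\<^sub>v (A *\<^sub>v w)"
    using assms(1) Suc.prems by (simp add: assoc_mult_mat_vec[of _ n n _ n])
  also have "\<dots> = krylov A (A *\<^sub>v w) k" using assms(1) Suc by simp
  finally show ?case by (simp only: krylov_Suc_right)
qed (use assms(1) in simp)

lemma hurwitz_iff:
  assumes "A \<in> carrier_mat n n"
  shows "hurwitz A \<longleftrightarrow>
    (\<forall>z. \<forall>w\<in>carrier_vec n. map_mat complex_of_real A *\<^sub>v w = z \<cdot>\<^sub>v w \<longrightarrow> w \<noteq> 0\<^sub>v n \<longrightarrow> Re z < 0)"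
  using assms by (auto simp: hurwitz_def eigenvalue_def eigenvector_def)

text \<open>An eigenvalue z of A makes (z + 1)^n an eigenvalue of the zero matrix, so z =
  -1.\<close>

lemma hurwitz_if_nilpotent:
  assumes A: "A \<in> carrier_mat n n" and nil: "nilpotent_mat (A + 1\<^sub>m n)"
  shows "hurwitz A"
proof -
  define N where "N = A + 1\<^sub>m n"
  have N: "N \<in> carrier_mat n n" using A by (simp add: N_def)
  have N0: "N ^\<^sub>m n = 0\<^sub>m n n"
  proof (rule eq_matI)
    fix i j assume "i < dim_row (0\<^sub>m n n)" "j < dim_col (0\<^sub>m n n)"
    then have ij: "i < n" "j < n" by auto
    have "(N ^\<^sub>m n) $$ (i,j) = (N ^\<^sub>m n *\<^sub>v unit_vec n j) $ i"
      using ij N by (simp add: pow_carrier_mat[OF N, THEN carrier_matD(1)] pow_carrier_mat[OF N, THEN carrier_matD(2)])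
    also have "N ^\<^sub>m n *\<^sub>v unit_vec n j = 0\<^sub>v n"
      using nilpotent_matD[OF nil[folded N_def] N] N by (simp add: pow_mat_mult_vec)
    finally show "(N ^\<^sub>m n) $$ (i,j) = 0\<^sub>m n n $$ (i,j)" using ij by simp
  qed (use pow_carrier_mat[OF N, of n] in auto)
  have "Re z < 0" if w: "w \<in> carrier_vec n" "w \<noteq> 0\<^sub>v n"
    and eig: "map_mat complex_of_real A *\<^sub>v w = z \<cdot>\<^sub>v w" for z w
  proof -
    define N' where "N' = map_mat complex_of_real N"
    have N': "N' \<in> carrier_mat n n" using N by (simp add: N'_def)
    have "N' = map_mat complex_of_real A + 1\<^sub>m n"
      using A by (intro eq_matI) (auto simp: N'_def N_def)
    then have "N' *\<^sub>v w = (z + 1) \<cdot>\<^sub>v w"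
      using A w eig by (simp add: add_mult_distrib_mat_vec[of _ n n] add_smult_distrib_vec)
    then have "eigenvector N' w (z + 1)"
      using N' w by (simp add: eigenvector_def)
    then have "(z + 1) ^ n \<cdot>\<^sub>v w = N' ^\<^sub>m n *\<^sub>v w"
      using eigenvector_pow[OF N'] by simp
    also have "N' ^\<^sub>m n = 0\<^sub>m n n"
      unfolding N'_def of_real_hom.mat_hom_pow[OF N, symmetric] N0 by (intro eq_matI) auto
    also have "\<dots> *\<^sub>v w = 0\<^sub>v n" using w by (intro eq_vecI) auto
    finally have "(z + 1) ^ n \<cdot>\<^sub>v w = 0\<^sub>v n" .
    then have "((z + 1) ^ n \<cdot>\<^sub>v w) $ i = 0" if "i < n" for i using that by simp
    moreover obtain i where "i < n" "w $ i \<noteq> 0" using w by (auto simp: vec_eq_iff)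
    ultimately have "(z + 1) ^ n = 0" using w(1) by fastforce
    then have "z = - 1" by (simp add: add_eq_0_iff2)
    then show ?thesis by simp
  qed
  then show ?thesis using hurwitz_iff[OF A] by blast
qed

text \<open>The Neumann series of \<open>(\<mu> - N)\<^bsup>-1\<^esup> y\<close>, which is finite for nilpotent \<open>N\<close>.\<close>

definition resolvent :: "real mat \<Rightarrow> real \<Rightarrow> real vec \<Rightarrow> real vec" where
  "resolvent N \<mu> y = vec (dim_row N) (\<lambda>i. \<Sum>k<dim_row N. krylov N y k $ i / \<mu> ^ Suc k)"

lemma resolvent_carrier [simp]: "N \<in> carrier_mat n n \<Longrightarrow> resolvent N \<mu> y \<in> carrier_vec n"
  by (simp add: resolvent_def)

lemma dim_resolvent [simp]: "dim_vec (resolvent N \<mu> y) = dim_row N"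
  by (simp add: resolvent_def)

lemma scalar_prod_resolvent:
  assumes N: "N \<in> carrier_mat n n" and y: "y \<in> carrier_vec n" and s: "s \<in> carrier_vec n"
  shows "s \<bullet> resolvent N \<mu> y = (\<Sum>k<n. (s \<bullet> krylov N y k) / \<mu> ^ Suc k)"
proof -
  have "s \<bullet> resolvent N \<mu> y = (\<Sum>i<n. \<Sum>k<n. s $ i * (krylov N y k $ i / \<mu> ^ Suc k))"
    using N by (simp add: scalar_prod_def resolvent_def lessThan_atLeast0 sum_distrib_left)
  also have "\<dots> = (\<Sum>k<n. \<Sum>i<n. s $ i * (krylov N y k $ i / \<mu> ^ Suc k))"
    by (rule sum.swap)
  also have "\<dots> = (\<Sum>k<n. (s \<bullet> krylov N y k) / \<mu> ^ Suc k)"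
    using N y by (simp add: scalar_prod_def lessThan_atLeast0 sum_divide_distrib)
  finally show ?thesis .
qed

lemma resolvent_eq:
  assumes N: "N \<in> carrier_mat n n" and nil: "nilpotent_mat N" and y: "y \<in> carrier_vec n"
    and \<mu>: "\<mu> \<noteq> 0"
  shows "\<mu> \<cdot>\<^sub>v resolvent N \<mu> y = N *\<^sub>v resolvent N \<mu> y + y"
proof (rule eq_vecI)
  fix i assume "i < dim_vec (N *\<^sub>v resolvent N \<mu> y + y)"
  then have i: "i < n" using y by simp
  define a where "a k = krylov N y k $ i / \<mu> ^ k" for k
  have "(N *\<^sub>v resolvent N \<mu> y) $ i = (\<Sum>k<n. (row N i \<bullet> krylov N y k) / \<mu> ^ Suc k)"
    using N y i scalar_prod_resolvent[OF N y, of "row N i" \<mu>] by simp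
  also have "\<dots> = (\<Sum>k<n. a (Suc k))"
    using N i by (simp add: a_def)
  \<comment> \<open>Applying N shifts the index of the series; the upper boundary term vanishes by
    nilpotency and the lower one is the forcing y.\<close>
  also have "\<dots> = (\<Sum>k<n. a k) + a n - a 0"
    by (induction n) simp_all
  also have "a n = 0" using nilpotent_matD[OF nil N y] i by (simp add: a_def)
  also have "a 0 = y $ i" by (simp add: a_def)
  also have "(\<Sum>k<n. a k) = \<mu> * resolvent N \<mu> y $ i"
    using N i \<mu> by (simp add: resolvent_def a_def sum_distrib_left)
  finally show "(\<mu> \<cdot>\<^sub>v resolvent N \<mu> y) $ i = (N *\<^sub>v resolvent N \<mu> y + y) $ i"
    using N y i by simp
qed (use N y in simp)

text \<open>Times \<mu>^n, the function is a polynomial in \<mu> whose coefficients are d and the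
  Markov parameters s . N^k b with k < n. If it were the zero polynomial, then d = 0, and since
  later Markov parameters vanish by nilpotency, s would be orthogonal to the whole Krylov sequence,
  so s = 0 by cyclicity.\<close>

lemma finite_zeros_transfer_function:
  assumes N: "N \<in> carrier_mat n n" and b: "b \<in> carrier_vec n"
    and nil: "nilpotent_mat N" and cyc: "cyclic_vec N b"
    and s: "s \<in> carrier_vec n" and nz: "s \<noteq> 0\<^sub>v n \<or> d \<noteq> 0"
  shows "finite {\<mu>. \<mu> \<noteq> 0 \<and> s \<bullet> resolvent N \<mu> b + d = 0}"
proof -
  define p where "p = monom d n + (\<Sum>k<n. monom (s \<bullet> krylov N b k) (n - Suc k))"
  have poly_p: "poly p \<mu> = \<mu> ^ n * (s \<bullet> resolvent N \<mu> b + d)" if "\<mu> \<noteq> 0" for \<mu>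
  proof -
    have "poly p \<mu> = d * \<mu> ^ n + (\<Sum>k<n. (s \<bullet> krylov N b k) * \<mu> ^ (n - Suc k))"
      by (simp add: p_def poly_monom poly_sum)
    also have "(\<Sum>k<n. (s \<bullet> krylov N b k) * \<mu> ^ (n - Suc k)) = \<mu> ^ n * (s \<bullet> resolvent N \<mu> b)"
      unfolding scalar_prod_resolvent[OF N b s] sum_distrib_left
      using that by (intro sum.cong) (auto simp: power_diff)
    finally show ?thesis by (simp add: algebra_simps)
  qed
  have "p \<noteq> 0"
  proof
    assume p0: "p = 0"
    have "coeff p n = d" by (auto simp: p_def coeff_sum coeff_monom intro!: sum.neutral)
    then have "d = 0" using p0 by simp
    have "s \<bullet> krylov N b k = 0" if k: "k < n" for k
    proof -
      \<comment> \<open>The exponents n - Suc j are pairwise distinct for j < n, so each coefficient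
        is a single Markov parameter.\<close>
      have "coeff p (n - Suc k) = (\<Sum>j<n. if n - Suc j = n - Suc k then s \<bullet> krylov N b j else 0)"
        using k by (simp add: p_def coeff_sum coeff_monom \<open>d = 0\<close>)
      also have "\<dots> = (\<Sum>j<n. if j = k then s \<bullet> krylov N b j else 0)"
        using k by (intro sum.cong) auto
      also have "\<dots> = s \<bullet> krylov N b k" using k by simp
      finally show ?thesis using p0 by simp
    qed
    moreover have "krylov N b (k + n) = 0\<^sub>v n" for k
      using nilpotent_matD[OF nil N b] N by (induction k) auto
    then have "krylov N b k = 0\<^sub>v n" if "k \<ge> n" for k
      using that by (metis le_add_diff_inverse2)
    ultimately have "s \<bullet> krylov N b k = 0" for k
      using s by (cases "k < n") auto
    then have "s = 0\<^sub>v n" using cyclic_vecD[OF cyc b s] by blast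
    then show False using nz \<open>d = 0\<close> by simp
  qed
  then have "finite {\<mu>. poly p \<mu> = 0}" by (rule poly_roots_finite)
  then show ?thesis by (rule rev_finite_subset) (auto simp: poly_p)
qed

text \<open>Deadbeat feedback for the shifted matrix A + 1 puts the whole spectrum of A + B F at
  -1.\<close>

lemma stabilizing_feedback:
  assumes A: "A \<in> carrier_mat n n" and B: "B \<in> carrier_mat n 1" and n: "n > 0"
    and cyc: "cyclic_vec A (col B 0)"
  obtains F where "F \<in> carrier_mat 1 n" "nilpotent_mat (A + B * F + 1\<^sub>m n)"
    "cyclic_vec (A + B * F + 1\<^sub>m n) (col B 0)"
proof -
  have b: "col B 0 \<in> carrier_vec n" using B by auto
  have A': "A + 1\<^sub>m n \<in> carrier_mat n n" using A by simp
  obtain F where F: "F \<in> carrier_mat 1 n"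
    and *: "nilpotent_mat (A + 1\<^sub>m n + B * F)" "cyclic_vec (A + 1\<^sub>m n + B * F) (col B 0)"
    using nilpotent_feedback[OF A' B n cyclic_vec_shift[OF A b cyc]] by blast
  have "A + 1\<^sub>m n + B * F = A + B * F + 1\<^sub>m n"
    using A B F by (intro eq_matI) (auto simp: algebra_simps)
  then show thesis using that[OF F] * by simp
qed

subsection \<open>Eigenvectors of the closed loops\<close>

declare One_nat_def [simp del]

lemma mult_mat_vec_carrier_iff [simp]: "A *\<^sub>v v \<in> carrier_vec n \<longleftrightarrow> dim_row A = n"
  unfolding carrier_vec_def mem_Collect_eq dim_mult_mat_vec ..

section \<open>Complexified real matrices acting on block vectors\<close>

abbreviation cmat :: "real mat \<Rightarrow> complex mat" where
  "cmat \<equiv> map_mat complex_of_real"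

abbreviation cvec :: "real vec \<Rightarrow> complex vec" where
  "cvec \<equiv> map_vec complex_of_real"

lemma cmat_mult_vec:
  assumes "A \<in> carrier_mat m n" "B \<in> carrier_mat n k" "v \<in> carrier_vec k"
  shows "cmat (A * B) *\<^sub>v v = cmat A *\<^sub>v (cmat B *\<^sub>v v)"
  using assms by (simp add: of_real_hom.mat_hom_mult[of A m n B k] assoc_mult_mat_vec[of _ m n _ k])

lemma cmat_add_mult_vec:
  assumes "A \<in> carrier_mat m n" "B \<in> carrier_mat m n" "v \<in> carrier_vec n"
  shows "cmat (A + B) *\<^sub>v v = cmat A *\<^sub>v v + cmat B *\<^sub>v v"
proof -
  have "cmat (A + B) = cmat A + cmat B" using assms by (intro eq_matI) auto
  then show ?thesis using assms by (simp add: add_mult_distrib_mat_vec[of _ m n])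
qed

lemma cmat_smult_mult_vec:
  assumes "A \<in> carrier_mat m n" "v \<in> carrier_vec n"
  shows "cmat (c \<cdot>\<^sub>m A) *\<^sub>v v = complex_of_real c \<cdot>\<^sub>v (cmat A *\<^sub>v v)"
  using assms by (intro eq_vecI) (auto simp: scalar_prod_def sum_distrib_left mult_ac)

lemma cmat_four_block_mult_vec:
  assumes "A \<in> carrier_mat m1 n1" "B \<in> carrier_mat m1 n2" "C \<in> carrier_mat m2 n1" "D \<in> carrier_mat m2 n2"
    and "a \<in> carrier_vec n1" "d \<in> carrier_vec n2"
  shows "cmat (four_block_mat A B C D) *\<^sub>v (a @\<^sub>v d) =
    (cmat A *\<^sub>v a + cmat B *\<^sub>v d) @\<^sub>v (cmat C *\<^sub>v a + cmat D *\<^sub>v d)"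
  unfolding map_four_block_mat[OF assms(1-4)] using assms
  by (intro four_block_mat_mult_vec[of _ m1 n1 _ n2 _ m2]) auto

lemma diag_block_mat_two: "diag_block_mat [A, B] = four_block_mat A
    (0\<^sub>m (dim_row A) (dim_col B)) (0\<^sub>m (dim_row B) (dim_col A)) B"
proof -
  \<comment> \<open>The recursion of \<open>diag_block_mat\<close> ends in an empty block, which is
    absorbed here.\<close>
  have "four_block_mat B (0\<^sub>m (dim_row B) 0) (0\<^sub>m 0 (dim_col B)) (0\<^sub>m 0 0) = B"
    by (intro eq_matI) auto
  then show ?thesis by (simp add: Let_def)
qed

lemma cmat_diag_mult_vec:
  assumes "A \<in> carrier_mat m1 n1" "B \<in> carrier_mat m2 n2" "a \<in> carrier_vec n1" "d \<in> carrier_vec n2"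
  shows "cmat (diag_block_mat [A, B]) *\<^sub>v (a @\<^sub>v d) = (cmat A *\<^sub>v a) @\<^sub>v (cmat B *\<^sub>v d)"
proof -
  have "cmat (0\<^sub>m m n) *\<^sub>v v = 0\<^sub>v m" if "v \<in> carrier_vec n" for m n and v :: "complex vec"
    using that by (intro eq_vecI) (auto simp: scalar_prod_def)
  then show ?thesis
    using assms unfolding diag_block_mat_two
    by (subst cmat_four_block_mult_vec[of _ m1 n1 _ n2 _ m2]) auto
qed

lemma diag_block_mat_two_carrier:
  assumes "A \<in> carrier_mat m1 n1" "B \<in> carrier_mat m2 n2"
  shows "diag_block_mat [A, B] \<in> carrier_mat (m1 + m2) (n1 + n2)"
  using assms unfolding diag_block_mat_two by (intro four_block_carrier_mat) auto

lemma smult_append_vec: "c \<cdot>\<^sub>v (v @\<^sub>v w) = (c \<cdot>\<^sub>v v) @\<^sub>v (c \<cdot>\<^sub>v w)"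
  by (intro eq_vecI) auto

lemma append_vec_eq_0:
  fixes v w :: "'a :: zero vec"
  assumes "v \<in> carrier_vec n" "w \<in> carrier_vec m"
  shows "v @\<^sub>v w = 0\<^sub>v (n + m) \<longleftrightarrow> v = 0\<^sub>v n \<and> w = 0\<^sub>v m"
proof -
  have "0\<^sub>v (n + m) = (0\<^sub>v n @\<^sub>v 0\<^sub>v m :: 'a vec)" by (intro eq_vecI) auto
  then show ?thesis by (simp only: append_vec_eq[OF assms(1) zero_carrier_vec])
qed

lemma ball_append_vec:
  "(\<forall>w\<in>carrier_vec (n + m). Q w) \<longleftrightarrow> (\<forall>x\<in>carrier_vec n. \<forall>y\<in>carrier_vec m. Q (x @\<^sub>v y))"
proof
  assume *: "\<forall>x\<in>carrier_vec n. \<forall>y\<in>carrier_vec m. Q (x @\<^sub>v y)"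
  show "\<forall>w\<in>carrier_vec (n + m). Q w"
  proof
    fix w :: "'a vec" assume "w \<in> carrier_vec (n + m)"
    then have "vec_first w n @\<^sub>v vec_last w m = w" by simp
    then show "Q w" using * by (metis vec_first_carrier vec_last_carrier)
  qed
qed auto

section \<open>Closed-loop eigenvectors as modes of the subsystems\<close>

text \<open>The number m of channels is a parameter, 1 for a local controller and 1 + 1 for
  \<open>diag_controller\<close>, so that one expansion of the closed loop serves both.\<close>

definition controller_dims :: "nat \<Rightarrow> nat \<Rightarrow> controller \<Rightarrow> bool" where
  "controller_dims q m \<kappa> \<longleftrightarrow> ctr_K \<kappa> \<in> carrier_mat q q \<and> ctr_H \<kappa> \<in> carrier_mat q m \<and>
     ctr_M \<kappa> \<in> carrier_mat m q \<and> ctr_N \<kappa> \<in> carrier_mat m m"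

lemma controller_dimsD:
  assumes "controller_dims q m \<kappa>"
  shows "ctr_K \<kappa> \<in> carrier_mat q q" "ctr_H \<kappa> \<in> carrier_mat q m"
    "ctr_M \<kappa> \<in> carrier_mat m q" "ctr_N \<kappa> \<in> carrier_mat m m"
  using assms by (simp_all add: controller_dims_def)

lemma is_subsystemD:
  assumes "is_subsystem n P"
  shows "sub_A P \<in> carrier_mat n n" "sub_B P \<in> carrier_mat n 1" "sub_J P \<in> carrier_mat n 1"
    "sub_C P \<in> carrier_mat 1 n" "sub_S P \<in> carrier_mat 1 n"
  using assms by (simp_all add: is_subsystem_def)

lemma closed_loop_mat_carrier:
  assumes "A \<in> carrier_mat n n" "B \<in> carrier_mat n m" "C \<in> carrier_mat m n" "controller_dims q m \<kappa>"
  shows "closed_loop_mat A B C \<kappa> \<in> carrier_mat (n + q) (n + q)"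
  using assms unfolding closed_loop_mat_def controller_dims_def by (intro four_block_carrier_mat) auto

lemma closed_loop_mat_mult_vec:
  assumes A: "A \<in> carrier_mat n n" and B: "B \<in> carrier_mat n m" and C: "C \<in> carrier_mat m n"
    and \<kappa>: "controller_dims q m \<kappa>" and x: "x \<in> carrier_vec n" and \<xi>: "\<xi> \<in> carrier_vec q"
  shows "cmat (closed_loop_mat A B C \<kappa>) *\<^sub>v (x @\<^sub>v \<xi>) =
    (cmat A *\<^sub>v x + cmat B *\<^sub>v (cmat (ctr_M \<kappa>) *\<^sub>v \<xi> + cmat (ctr_N \<kappa>) *\<^sub>v (cmat C *\<^sub>v x))) @\<^sub>v
    (cmat (ctr_K \<kappa>) *\<^sub>v \<xi> + cmat (ctr_H \<kappa>) *\<^sub>v (cmat C *\<^sub>v x))"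
proof -
  have K: "ctr_K \<kappa> \<in> carrier_mat q q" and H: "ctr_H \<kappa> \<in> carrier_mat q m"
    and M: "ctr_M \<kappa> \<in> carrier_mat m q" and N: "ctr_N \<kappa> \<in> carrier_mat m m"
    using controller_dimsD[OF \<kappa>] .
  define a b c where "a = cmat A *\<^sub>v x" and "b = cmat B *\<^sub>v (cmat (ctr_N \<kappa>) *\<^sub>v (cmat C *\<^sub>v x))"
    and "c = cmat B *\<^sub>v (cmat (ctr_M \<kappa>) *\<^sub>v \<xi>)"
  have abc: "a \<in> carrier_vec n" "b \<in> carrier_vec n" "c \<in> carrier_vec n"
    using A B by (auto simp: a_def b_def c_def)
  have BN: "B * ctr_N \<kappa> \<in> carrier_mat n m" using B N by simp
  have "cmat (closed_loop_mat A B C \<kappa>) *\<^sub>v (x @\<^sub>v \<xi>) =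
    (cmat (A + B * ctr_N \<kappa> * C) *\<^sub>v x + cmat (B * ctr_M \<kappa>) *\<^sub>v \<xi>) @\<^sub>v
    (cmat (ctr_H \<kappa> * C) *\<^sub>v x + cmat (ctr_K \<kappa>) *\<^sub>v \<xi>)"
    unfolding closed_loop_mat_def using A B C K H M N x \<xi>
    by (intro cmat_four_block_mult_vec[of _ n n _ q _ q]) auto
  also have "cmat (A + B * ctr_N \<kappa> * C) *\<^sub>v x = a + b"
    unfolding a_def b_def cmat_add_mult_vec[OF A mult_carrier_mat[OF BN C] x] cmat_mult_vec[OF BN C x]
    using cmat_mult_vec[OF B N, of "cmat C *\<^sub>v x"] C by simp
  also have "cmat (B * ctr_M \<kappa>) *\<^sub>v \<xi> = c"
    using cmat_mult_vec[OF B M \<xi>] by (simp add: c_def)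
  also have "cmat (ctr_H \<kappa> * C) *\<^sub>v x = cmat (ctr_H \<kappa>) *\<^sub>v (cmat C *\<^sub>v x)"
    using cmat_mult_vec[OF H C x] .
  also have "a + b + c = a + (c + b)"
    using abc by (simp add: assoc_add_vec[of _ n] comm_add_vec[of b n c])
  also have "c + b = cmat B *\<^sub>v (cmat (ctr_M \<kappa>) *\<^sub>v \<xi> + cmat (ctr_N \<kappa>) *\<^sub>v (cmat C *\<^sub>v x))"
    unfolding b_def c_def using B C M N x \<xi>
    by (intro mult_add_distrib_mat_vec[symmetric, of _ n m]) auto
  also have "cmat (ctr_H \<kappa>) *\<^sub>v (cmat C *\<^sub>v x) + cmat (ctr_K \<kappa>) *\<^sub>v \<xi> =
      cmat (ctr_K \<kappa>) *\<^sub>v \<xi> + cmat (ctr_H \<kappa>) *\<^sub>v (cmat C *\<^sub>v x)"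
    using H K by (intro comm_add_vec[of _ q]) auto
  finally show ?thesis by (simp add: a_def)
qed

text \<open>\<open>(x, \<xi>)\<close> solves the local closed-loop equations with every signal proportional to \<open>e\<^bsup>z t\<^esup>\<close> and
  the external input having amplitude \<open>\<zeta>\<close>.\<close>

definition mode :: "subsystem \<Rightarrow> controller \<Rightarrow> complex \<Rightarrow> complex vec \<Rightarrow> complex vec \<Rightarrow> complex vec \<Rightarrow> bool" where
  "mode P \<kappa> z x \<xi> \<zeta> \<longleftrightarrow>
     (let y = cmat (sub_C P) *\<^sub>v x + complex_of_real (sub_D P) \<cdot>\<^sub>v \<zeta>;
          u = cmat (ctr_M \<kappa>) *\<^sub>v \<xi> + cmat (ctr_N \<kappa>) *\<^sub>v y
      in z \<cdot>\<^sub>v x = cmat (sub_A P) *\<^sub>v x + cmat (sub_J P) *\<^sub>v \<zeta> + cmat (sub_B P) *\<^sub>v u \<and>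
         z \<cdot>\<^sub>v \<xi> = cmat (ctr_K \<kappa>) *\<^sub>v \<xi> + cmat (ctr_H \<kappa>) *\<^sub>v y)"

lemma locally_stable_iff:
  assumes P: "is_subsystem n P" and \<kappa>: "controller_dims q 1 \<kappa>"
  shows "locally_stable P \<kappa> \<longleftrightarrow>
    (\<forall>z. \<forall>x\<in>carrier_vec n. \<forall>\<xi>\<in>carrier_vec q. mode P \<kappa> z x \<xi> (0\<^sub>v 1) \<longrightarrow>
       \<not> (x = 0\<^sub>v n \<and> \<xi> = 0\<^sub>v q) \<longrightarrow> Re z < 0)"
proof -
  note P' = is_subsystemD[OF P] controller_dimsD[OF \<kappa>]
  have "cmat (closed_loop_mat (sub_A P) (sub_B P) (sub_C P) \<kappa>) *\<^sub>v (x @\<^sub>v \<xi>) = z \<cdot>\<^sub>v (x @\<^sub>v \<xi>) \<longleftrightarrow>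
      mode P \<kappa> z x \<xi> (0\<^sub>v 1)" if x: "x \<in> carrier_vec n" and \<xi>: "\<xi> \<in> carrier_vec q" for z x \<xi>
  proof -
    have y: "cmat (sub_C P) *\<^sub>v x + complex_of_real (sub_D P) \<cdot>\<^sub>v 0\<^sub>v 1 = cmat (sub_C P) *\<^sub>v x"
      using P' by (intro eq_vecI) auto
    have J: "cmat (sub_A P) *\<^sub>v x + cmat (sub_J P) *\<^sub>v 0\<^sub>v 1 = cmat (sub_A P) *\<^sub>v x"
      using P' by (intro eq_vecI) auto
    define u where "u = cmat (ctr_M \<kappa>) *\<^sub>v \<xi> + cmat (ctr_N \<kappa>) *\<^sub>v (cmat (sub_C P) *\<^sub>v x)"
    have dim: "cmat (sub_A P) *\<^sub>v x + cmat (sub_B P) *\<^sub>v u \<in> carrier_vec n" "z \<cdot>\<^sub>v x \<in> carrier_vec n"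
      using P' x by auto
    show ?thesis
      unfolding mode_def y J Let_def u_def[symmetric] smult_append_vec
        closed_loop_mat_mult_vec[OF P'(1,2,4) \<kappa> x \<xi>] append_vec_eq[OF dim]
      by auto
  qed
  moreover have "closed_loop_mat (sub_A P) (sub_B P) (sub_C P) \<kappa> \<in> carrier_mat (n + q) (n + q)"
    using P' \<kappa> by (intro closed_loop_mat_carrier) auto
  ultimately show ?thesis
    unfolding locally_stable_def by (simp add: hurwitz_iff ball_append_vec append_vec_eq_0)
qed

text \<open>Interconnecting only identifies the external input of each subsystem with S x of the
  other. So an overall eigenvector is a pair of local modes with matching amplitudes, which lets
  modes be glued for instability and separated for cascades.\<close>

lemma overall_stable_iff:
  assumes P1: "is_subsystem n1 P1" and P2: "is_subsystem n2 P2"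
    and \<kappa>1: "controller_dims q1 1 \<kappa>1" and \<kappa>2: "controller_dims q2 1 \<kappa>2"
  shows "overall_stable P1 P2 \<kappa>1 \<kappa>2 \<longleftrightarrow>
    (\<forall>z. \<forall>x1\<in>carrier_vec n1. \<forall>x2\<in>carrier_vec n2. \<forall>\<xi>1\<in>carrier_vec q1. \<forall>\<xi>2\<in>carrier_vec q2.
       mode P1 \<kappa>1 z x1 \<xi>1 (cmat (sub_S P2) *\<^sub>v x2) \<and> mode P2 \<kappa>2 z x2 \<xi>2 (cmat (sub_S P1) *\<^sub>v x1) \<longrightarrow>
       \<not> ((x1 = 0\<^sub>v n1 \<and> x2 = 0\<^sub>v n2) \<and> \<xi>1 = 0\<^sub>v q1 \<and> \<xi>2 = 0\<^sub>v q2) \<longrightarrow> Re z < 0)"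
proof -
  note P1' = is_subsystemD[OF P1] controller_dimsD[OF \<kappa>1]
  note P2' = is_subsystemD[OF P2] controller_dimsD[OF \<kappa>2]
  have J1: "sub_J P1 * sub_S P2 \<in> carrier_mat n1 n2" and J2: "sub_J P2 * sub_S P1 \<in> carrier_mat n2 n1"
    using P1' P2' by auto
  have D1: "sub_D P1 \<cdot>\<^sub>m sub_S P2 \<in> carrier_mat 1 n2" and D2: "sub_D P2 \<cdot>\<^sub>m sub_S P1 \<in> carrier_mat 1 n1"
    using P1' P2' by auto
  have A: "sys_A P1 P2 \<in> carrier_mat (n1 + n2) (n1 + n2)"
    unfolding sys_A_def using P1' P2' by (intro four_block_carrier_mat) auto
  have B: "sys_B P1 P2 \<in> carrier_mat (n1 + n2) (1 + 1)"
    unfolding sys_B_def using P1' P2' by (intro diag_block_mat_two_carrier) auto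
  have C: "sys_C P1 P2 \<in> carrier_mat (1 + 1) (n1 + n2)"
    unfolding sys_C_def using P1' P2' by (intro four_block_carrier_mat) auto
  have \<kappa>: "controller_dims (q1 + q2) (1 + 1) (diag_controller \<kappa>1 \<kappa>2)"
    unfolding diag_controller_def controller_dims_def controller.simps
    by (intro conjI diag_block_mat_two_carrier P1' P2')
  let ?cl = "closed_loop_mat (sys_A P1 P2) (sys_B P1 P2) (sys_C P1 P2) (diag_controller \<kappa>1 \<kappa>2)"
  have "cmat ?cl *\<^sub>v ((x1 @\<^sub>v x2) @\<^sub>v (\<xi>1 @\<^sub>v \<xi>2)) = z \<cdot>\<^sub>v ((x1 @\<^sub>v x2) @\<^sub>v (\<xi>1 @\<^sub>v \<xi>2)) \<longleftrightarrow>
      mode P1 \<kappa>1 z x1 \<xi>1 (cmat (sub_S P2) *\<^sub>v x2) \<and> mode P2 \<kappa>2 z x2 \<xi>2 (cmat (sub_S P1) *\<^sub>v x1)"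
    if x: "x1 \<in> carrier_vec n1" "x2 \<in> carrier_vec n2"
      and \<xi>: "\<xi>1 \<in> carrier_vec q1" "\<xi>2 \<in> carrier_vec q2" for z x1 x2 \<xi>1 \<xi>2
  proof -
    define y1 y2 where
      "y1 = cmat (sub_C P1) *\<^sub>v x1 + complex_of_real (sub_D P1) \<cdot>\<^sub>v (cmat (sub_S P2) *\<^sub>v x2)" and
      "y2 = cmat (sub_C P2) *\<^sub>v x2 + complex_of_real (sub_D P2) \<cdot>\<^sub>v (cmat (sub_S P1) *\<^sub>v x1)"
    define u1 u2 where
      "u1 = cmat (ctr_M \<kappa>1) *\<^sub>v \<xi>1 + cmat (ctr_N \<kappa>1) *\<^sub>v y1" and
      "u2 = cmat (ctr_M \<kappa>2) *\<^sub>v \<xi>2 + cmat (ctr_N \<kappa>2) *\<^sub>v y2"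
    define a1 a2 where
      "a1 = cmat (sub_A P1) *\<^sub>v x1 + cmat (sub_J P1) *\<^sub>v (cmat (sub_S P2) *\<^sub>v x2)" and
      "a2 = cmat (sub_A P2) *\<^sub>v x2 + cmat (sub_J P2) *\<^sub>v (cmat (sub_S P1) *\<^sub>v x1)"
    define k1 k2 where
      "k1 = cmat (ctr_K \<kappa>1) *\<^sub>v \<xi>1 + cmat (ctr_H \<kappa>1) *\<^sub>v y1" and
      "k2 = cmat (ctr_K \<kappa>2) *\<^sub>v \<xi>2 + cmat (ctr_H \<kappa>2) *\<^sub>v y2"
    have y: "y1 \<in> carrier_vec 1" "y2 \<in> carrier_vec 1" and u: "u1 \<in> carrier_vec 1" "u2 \<in> carrier_vec 1"
      and a: "a1 \<in> carrier_vec n1" "a2 \<in> carrier_vec n2" and k: "k1 \<in> carrier_vec q1" "k2 \<in> carrier_vec q2"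
      using P1' P2' x unfolding y1_def y2_def u1_def u2_def a1_def a2_def k1_def k2_def by auto
    have Cx: "cmat (sys_C P1 P2) *\<^sub>v (x1 @\<^sub>v x2) = y1 @\<^sub>v y2"
      unfolding sys_C_def using P1' P2' x D1 D2
      by (simp add: cmat_four_block_mult_vec[of _ 1 n1 _ n2 _ 1] cmat_smult_mult_vec[of _ 1]
          y1_def y2_def comm_add_vec[of "cmat (sub_C P2) *\<^sub>v x2" 1])
    have Ax: "cmat (sys_A P1 P2) *\<^sub>v (x1 @\<^sub>v x2) = a1 @\<^sub>v a2"
      unfolding sys_A_def using P1' P2' x J1 J2
      by (simp add: cmat_four_block_mult_vec[of _ n1 n1 _ n2 _ n2] cmat_mult_vec[of _ n1 1 _ n2]
          cmat_mult_vec[of _ n2 1 _ n1] a1_def a2_def comm_add_vec[of "cmat (sub_A P2) *\<^sub>v x2" n2])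
    have uu: "cmat (ctr_M (diag_controller \<kappa>1 \<kappa>2)) *\<^sub>v (\<xi>1 @\<^sub>v \<xi>2) +
        cmat (ctr_N (diag_controller \<kappa>1 \<kappa>2)) *\<^sub>v (y1 @\<^sub>v y2) = u1 @\<^sub>v u2"
      using P1' P2' \<xi> y
      by (simp add: diag_controller_def u1_def u2_def cmat_diag_mult_vec[of _ 1 q1 _ 1 q2]
          cmat_diag_mult_vec[of _ 1 1 _ 1 1] append_vec_add[of _ 1 _ _ 1] del: diag_block_mat.simps)
    have Bu: "cmat (sys_B P1 P2) *\<^sub>v (u1 @\<^sub>v u2) = (cmat (sub_B P1) *\<^sub>v u1) @\<^sub>v (cmat (sub_B P2) *\<^sub>v u2)"
      unfolding sys_B_def using P1' P2' u by (intro cmat_diag_mult_vec) auto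
    have kk: "cmat (ctr_K (diag_controller \<kappa>1 \<kappa>2)) *\<^sub>v (\<xi>1 @\<^sub>v \<xi>2) +
        cmat (ctr_H (diag_controller \<kappa>1 \<kappa>2)) *\<^sub>v (y1 @\<^sub>v y2) = k1 @\<^sub>v k2"
      using P1' P2' \<xi> y
      by (simp add: diag_controller_def k1_def k2_def cmat_diag_mult_vec[of _ q1 q1 _ q2 q2]
          cmat_diag_mult_vec[of _ q1 1 _ q2 1] append_vec_add[of _ q1 _ _ q2] del: diag_block_mat.simps)
    have "cmat ?cl *\<^sub>v ((x1 @\<^sub>v x2) @\<^sub>v (\<xi>1 @\<^sub>v \<xi>2)) =
        ((a1 @\<^sub>v a2) + ((cmat (sub_B P1) *\<^sub>v u1) @\<^sub>v (cmat (sub_B P2) *\<^sub>v u2))) @\<^sub>v (k1 @\<^sub>v k2)"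
      using closed_loop_mat_mult_vec[OF A B C \<kappa>, of "x1 @\<^sub>v x2" "\<xi>1 @\<^sub>v \<xi>2"] x \<xi>
      by (simp add: Cx Ax uu Bu kk)
    also have "(a1 @\<^sub>v a2) + ((cmat (sub_B P1) *\<^sub>v u1) @\<^sub>v (cmat (sub_B P2) *\<^sub>v u2)) =
        (a1 + cmat (sub_B P1) *\<^sub>v u1) @\<^sub>v (a2 + cmat (sub_B P2) *\<^sub>v u2)"
      using a P1' P2' by (intro append_vec_add) auto
    finally have cl: "cmat ?cl *\<^sub>v ((x1 @\<^sub>v x2) @\<^sub>v (\<xi>1 @\<^sub>v \<xi>2)) =
        ((a1 + cmat (sub_B P1) *\<^sub>v u1) @\<^sub>v (a2 + cmat (sub_B P2) *\<^sub>v u2)) @\<^sub>v (k1 @\<^sub>v k2)" .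
    have dims: "a1 + cmat (sub_B P1) *\<^sub>v u1 \<in> carrier_vec n1" "a2 + cmat (sub_B P2) *\<^sub>v u2 \<in> carrier_vec n2"
      using P1' P2' a by auto
    have m1: "mode P1 \<kappa>1 z x1 \<xi>1 (cmat (sub_S P2) *\<^sub>v x2) \<longleftrightarrow>
        z \<cdot>\<^sub>v x1 = a1 + cmat (sub_B P1) *\<^sub>v u1 \<and> z \<cdot>\<^sub>v \<xi>1 = k1"
      unfolding mode_def Let_def a1_def k1_def u1_def y1_def ..
    have m2: "mode P2 \<kappa>2 z x2 \<xi>2 (cmat (sub_S P1) *\<^sub>v x1) \<longleftrightarrow>
        z \<cdot>\<^sub>v x2 = a2 + cmat (sub_B P2) *\<^sub>v u2 \<and> z \<cdot>\<^sub>v \<xi>2 = k2"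
      unfolding mode_def Let_def a2_def k2_def u2_def y2_def ..
    have "(a1 + cmat (sub_B P1) *\<^sub>v u1) @\<^sub>v (a2 + cmat (sub_B P2) *\<^sub>v u2) \<in> carrier_vec (n1 + n2)"
      "(z \<cdot>\<^sub>v x1) @\<^sub>v (z \<cdot>\<^sub>v x2) \<in> carrier_vec (n1 + n2)" "z \<cdot>\<^sub>v x1 \<in> carrier_vec n1" "z \<cdot>\<^sub>v \<xi>1 \<in> carrier_vec q1"
      using x \<xi> dims by auto
    then show ?thesis
      unfolding cl m1 m2 smult_append_vec using dims(1) k(1)
      by (auto simp: append_vec_eq[of _ "n1 + n2"] append_vec_eq[of _ n1] append_vec_eq[of _ q1])
  qed
  moreover have "?cl \<in> carrier_mat ((n1 + n2) + (q1 + q2)) ((n1 + n2) + (q1 + q2))"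
    using A B C \<kappa> by (rule closed_loop_mat_carrier)
  ultimately show ?thesis
    unfolding overall_stable_def
    by (simp add: hurwitz_iff[of _ "(n1 + n2) + (q1 + q2)"] ball_append_vec append_vec_eq_0) blast
qed

subsection \<open>Observer-based controllers\<close>

text \<open>Applied to S, it turns the interconnection output into one fixed functional of the
  forcing. Applied to C, it makes the cyclic vector of the dual pair the argument of the
  resolvent.\<close>

lemma resolvent_adjoint:
  assumes N: "N \<in> carrier_mat n n" and y: "y \<in> carrier_vec n" and s: "s \<in> carrier_vec n"
  shows "s \<bullet> resolvent N \<mu> y = resolvent N\<^sup>T \<mu> s \<bullet> y"
proof -
  have NT: "N\<^sup>T \<in> carrier_mat n n" using N by simp
  have "resolvent N\<^sup>T \<mu> s \<bullet> y = y \<bullet> resolvent N\<^sup>T \<mu> s"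
    using NT y by (intro comm_scalar_prod[of _ n]) auto
  also have "\<dots> = (\<Sum>k<n. (y \<bullet> krylov N\<^sup>T s k) / \<mu> ^ Suc k)"
    using NT s y by (rule scalar_prod_resolvent)
  also have "\<dots> = (\<Sum>k<n. (s \<bullet> krylov N y k) / \<mu> ^ Suc k)"
    using krylov_adjoint[OF N s y] comm_scalar_prod[OF y krylov_carrier[OF NT s]] by simp
  also have "\<dots> = s \<bullet> resolvent N \<mu> y"
    using N y s by (rule scalar_prod_resolvent[symmetric])
  finally show ?thesis ..
qed

text \<open>The resolvent of A at \<sigma> is that of the nilpotent A + 1 at \<sigma> + 1, and
  \<sigma> > -1 stays away from its only pole.\<close>

lemma resolvent_shift_eq:
  assumes A: "A \<in> carrier_mat n n" and nil: "nilpotent_mat (A + 1\<^sub>m n)" and y: "y \<in> carrier_vec n"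
    and \<sigma>: "\<sigma> > - 1"
  shows "\<sigma> \<cdot>\<^sub>v resolvent (A + 1\<^sub>m n) (\<sigma> + 1) y = A *\<^sub>v resolvent (A + 1\<^sub>m n) (\<sigma> + 1) y + y"
proof -
  define x where "x = resolvent (A + 1\<^sub>m n) (\<sigma> + 1) y"
  have A1: "A + 1\<^sub>m n \<in> carrier_mat n n" using A by simp
  have x: "x \<in> carrier_vec n" unfolding x_def using A1 by simp
  have "(\<sigma> + 1) \<cdot>\<^sub>v x = (A + 1\<^sub>m n) *\<^sub>v x + y"
    unfolding x_def using A1 nil y \<sigma> by (intro resolvent_eq) auto
  also have "(A + 1\<^sub>m n) *\<^sub>v x = A *\<^sub>v x + x"
    using A x by (simp add: add_mult_distrib_mat_vec[of _ n n])
  finally have eq: "(\<sigma> + 1) \<cdot>\<^sub>v x = A *\<^sub>v x + x + y" .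
  have "(\<sigma> \<cdot>\<^sub>v x) $ i = (A *\<^sub>v x + y) $ i" if i: "i < n" for i
    using arg_cong[OF eq, of "\<lambda>v. v $ i"] i A x y
    by (simp add: algebra_simps del: index_mult_mat_vec)
  then have "\<sigma> \<cdot>\<^sub>v x = A *\<^sub>v x + y" using A x y by (intro eq_vecI) auto
  then show ?thesis by (simp add: x_def)
qed

lemma cvec_eq:
  assumes A: "A \<in> carrier_mat n n" and x: "x \<in> carrier_vec n" and y: "y \<in> carrier_vec n"
    and eq: "\<sigma> \<cdot>\<^sub>v x = A *\<^sub>v x + y"
  shows "complex_of_real \<sigma> \<cdot>\<^sub>v cvec x = cmat A *\<^sub>v cvec x + cvec y"
proof -
  have "complex_of_real \<sigma> \<cdot>\<^sub>v cvec x = cvec (A *\<^sub>v x + y)"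
    unfolding eq[symmetric] of_real_hom.vec_hom_smult ..
  also have "\<dots> = cvec (A *\<^sub>v x) + cvec y" using A x y by (intro eq_vecI) auto
  finally show ?thesis unfolding of_real_hom.mult_mat_vec_hom[OF A x] .
qed

lemma scalar_mult_mat_vec_index:
  fixes B :: "'a :: comm_semiring_0 mat"
  assumes "B \<in> carrier_mat n 1" "u \<in> carrier_vec 1" "i < n"
  shows "(B *\<^sub>v u) $ i = B $$ (i,0) * u $ 0"
  using assms by (simp add: scalar_prod_def One_nat_def)

lemma cmat_minus_mult_vec:
  assumes "A \<in> carrier_mat m n" "B \<in> carrier_mat m n" "v \<in> carrier_vec n"
  shows "cmat (A - B) *\<^sub>v v = cmat A *\<^sub>v v - cmat B *\<^sub>v v"
proof -
  have "cmat (A - B) = cmat A - cmat B" using assms by (intro eq_matI) auto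
  then show ?thesis using assms by (simp add: minus_mult_distrib_mat_vec[of _ m n])
qed

text \<open>State feedback \<open>F\<close> on a Luenberger observer with gain \<open>- L\<close>, plus the static Youla parameter
  \<open>q\<close> acting on the innovation \<open>y - C \<xi>\<close>.\<close>

definition observer_controller :: "subsystem \<Rightarrow> real mat \<Rightarrow> real mat \<Rightarrow> real \<Rightarrow> controller" where
  "observer_controller P F L q =
     \<lparr>ctr_K = sub_A P + sub_B P * F - q \<cdot>\<^sub>m (sub_B P * sub_C P) + L * sub_C P,
      ctr_H = q \<cdot>\<^sub>m sub_B P - L,
      ctr_M = F - q \<cdot>\<^sub>m sub_C P,
      ctr_N = q \<cdot>\<^sub>m 1\<^sub>m 1\<rparr>"

lemma observer_controller_dims:
  assumes "is_subsystem n P" "F \<in> carrier_mat 1 n" "L \<in> carrier_mat n 1"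
  shows "controller_dims n 1 (observer_controller P F L q)"
  using is_subsystemD[OF assms(1)] assms(2,3)
  by (simp add: controller_dims_def minus_carrier_mat observer_controller_def)

text \<open>The separation principle for the estimation error e = x - \<xi>. The controller amounts
  to \<xi>' = A \<xi> + B u - L (y - C \<xi>) with u = F \<xi> + q (y - C \<xi>), and the innovation
  y - C \<xi> equals C e + D \<zeta>. Subtraction cancels B u, so neither F nor q affects e, and q
  enters only the forcing of x.\<close>

lemma mode_observer_controller:
  assumes P: "is_subsystem n P" and F: "F \<in> carrier_mat 1 n" and L: "L \<in> carrier_mat n 1"
    and x: "x \<in> carrier_vec n" and e: "e \<in> carrier_vec n" and \<zeta>: "\<zeta> \<in> carrier_vec 1"
  shows "mode P (observer_controller P F L q) z x (x - e) \<zeta> \<longleftrightarrow>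
    z \<cdot>\<^sub>v e = cmat (sub_A P + L * sub_C P) *\<^sub>v e + cmat (sub_J P + sub_D P \<cdot>\<^sub>m L) *\<^sub>v \<zeta> \<and>
    z \<cdot>\<^sub>v x = cmat (sub_A P + sub_B P * F) *\<^sub>v x +
      (cmat (sub_B P) *\<^sub>v (complex_of_real q \<cdot>\<^sub>v
          (cmat (sub_C P) *\<^sub>v e + complex_of_real (sub_D P) \<cdot>\<^sub>v \<zeta>) - cmat F *\<^sub>v e) + cmat (sub_J P) *\<^sub>v \<zeta>)"
    (is "_ \<longleftrightarrow> z \<cdot>\<^sub>v e = ?re \<and> z \<cdot>\<^sub>v x = ?rx")
proof -
  note P' = is_subsystemD[OF P]
  note \<kappa> = controller_dimsD[OF observer_controller_dims[OF P F L], of q]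
  let ?\<kappa> = "observer_controller P F L q"
  define \<xi> where "\<xi> = x - e"
  have \<xi>: "\<xi> \<in> carrier_vec n" using x e by (simp add: \<xi>_def)
  define y where "y = cmat (sub_C P) *\<^sub>v x + complex_of_real (sub_D P) \<cdot>\<^sub>v \<zeta>"
  define u where "u = cmat (ctr_M ?\<kappa>) *\<^sub>v \<xi> + cmat (ctr_N ?\<kappa>) *\<^sub>v y"
  define rx' where "rx' = cmat (sub_A P) *\<^sub>v x + cmat (sub_J P) *\<^sub>v \<zeta> + cmat (sub_B P) *\<^sub>v u"
  define r\<xi> where "r\<xi> = cmat (ctr_K ?\<kappa>) *\<^sub>v \<xi> + cmat (ctr_H ?\<kappa>) *\<^sub>v y"
  have y: "y \<in> carrier_vec 1" and u: "u \<in> carrier_vec 1" using P' \<kappa> \<zeta> by (auto simp: y_def u_def)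
  \<comment> \<open>As all signals are scalar, every equation can be compared entry by entry, as a
    ring identity in these abbreviations.\<close>
  define a c f where "a v = cmat (sub_A P) *\<^sub>v v" and "c v = (cmat (sub_C P) *\<^sub>v v) $ 0"
    and "f v = (cmat F *\<^sub>v v) $ 0" for v
  define B J where "B i = complex_of_real (sub_B P $$ (i,0))" and "J i = complex_of_real (sub_J P $$ (i,0))" for i
  define l where "l i = complex_of_real (L $$ (i,0))" for i
  define Q D where "Q = complex_of_real q" and "D = complex_of_real (sub_D P)"
  have a\<xi>: "a \<xi> $ i = a x $ i - a e $ i" if "i < n" for i
    using that P' x e by (simp add: a_def \<xi>_def mult_minus_distrib_mat_vec[of _ n n] del: index_mult_mat_vec)
  have c\<xi>: "c \<xi> = c x - c e"
    using P' x e by (simp add: c_def \<xi>_def mult_minus_distrib_mat_vec[of _ 1 n] del: index_mult_mat_vec)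
  have f\<xi>: "f \<xi> = f x - f e"
    using F x e by (simp add: f_def \<xi>_def mult_minus_distrib_mat_vec[of _ 1 n] del: index_mult_mat_vec)
  have col: "(cmat G *\<^sub>v v) $ i = complex_of_real (G $$ (i,0)) * v $ 0"
    if "G \<in> carrier_mat n 1" "v \<in> carrier_vec 1" "i < n" for G v i
    using that scalar_mult_mat_vec_index[of "cmat G" n v i] by simp
  have y0: "y $ 0 = c x + D * \<zeta> $ 0"
    using P' \<zeta> by (simp add: y_def c_def D_def del: index_mult_mat_vec)
  have N: "(cmat (ctr_N ?\<kappa>) *\<^sub>v y) $ 0 = Q * y $ 0"
    using y by (simp add: observer_controller_def Q_def scalar_prod_def One_nat_def)
  have u0: "u $ 0 = f \<xi> - Q * c \<xi> + Q * y $ 0"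
  proof -
    have "cmat (ctr_M ?\<kappa>) *\<^sub>v \<xi> = cmat F *\<^sub>v \<xi> - Q \<cdot>\<^sub>v (cmat (sub_C P) *\<^sub>v \<xi>)"
      using P' F \<xi> by (simp add: observer_controller_def cmat_minus_mult_vec[of _ 1 n]
          cmat_smult_mult_vec[of _ 1 n] Q_def)
    then show ?thesis
      using P' F \<kappa> y N by (simp add: u_def f_def c_def del: index_mult_mat_vec)
  qed
  have K: "(cmat (ctr_K ?\<kappa>) *\<^sub>v \<xi>) $ i = a \<xi> $ i + B i * f \<xi> - Q * (B i * c \<xi>) + l i * c \<xi>"
    if i: "i < n" for i
  proof -
    have "cmat (ctr_K ?\<kappa>) *\<^sub>v \<xi> = a \<xi> + cmat (sub_B P) *\<^sub>v (cmat F *\<^sub>v \<xi>) -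
        Q \<cdot>\<^sub>v (cmat (sub_B P) *\<^sub>v (cmat (sub_C P) *\<^sub>v \<xi>)) + cmat L *\<^sub>v (cmat (sub_C P) *\<^sub>v \<xi>)"
      using P' F L \<xi>
      by (simp add: observer_controller_def cmat_minus_mult_vec[of _ n n] cmat_add_mult_vec[of _ n n]
          cmat_smult_mult_vec[of _ n n] cmat_mult_vec[of _ n 1 _ n] minus_carrier_mat Q_def a_def)
    then show ?thesis
      using P' F L i by (simp add: col B_def l_def f_def c_def del: index_mult_mat_vec)
  qed
  have H: "(cmat (ctr_H ?\<kappa>) *\<^sub>v y) $ i = (Q * B i - l i) * y $ 0" if i: "i < n" for i
    unfolding col[OF \<kappa>(2) y i] using i P' L by (simp add: observer_controller_def B_def l_def Q_def)
  have rx'_i: "rx' $ i = a x $ i + J i * \<zeta> $ 0 + B i * u $ 0" if "i < n" for i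
    using that P' \<zeta> u by (simp add: rx'_def a_def col B_def J_def del: index_mult_mat_vec)
  have r\<xi>_i: "r\<xi> $ i = a \<xi> $ i + B i * f \<xi> - Q * (B i * c \<xi>) + l i * c \<xi> + (Q * B i - l i) * y $ 0"
    if "i < n" for i
    using that \<kappa> K H by (simp add: r\<xi>_def del: index_mult_mat_vec)
  have re_i: "?re $ i = a e $ i + l i * c e + (J i + D * l i) * \<zeta> $ 0" if i: "i < n" for i
  proof -
    have "cmat (sub_A P + L * sub_C P) *\<^sub>v e = a e + cmat L *\<^sub>v (cmat (sub_C P) *\<^sub>v e)"
      using P' L e by (simp add: cmat_add_mult_vec[of _ n n] cmat_mult_vec[of _ n 1 _ n] a_def)
    moreover have "(cmat (sub_J P + sub_D P \<cdot>\<^sub>m L) *\<^sub>v \<zeta>) $ i = (J i + D * l i) * \<zeta> $ 0"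
      using i P' L \<zeta> by (subst col) (auto simp: J_def D_def l_def)
    ultimately show ?thesis
      using i P' L by (simp add: col l_def c_def del: index_mult_mat_vec)
  qed
  have rx_i: "?rx $ i = a x $ i + B i * f x + (B i * (Q * (c e + D * \<zeta> $ 0) - f e) + J i * \<zeta> $ 0)"
    if i: "i < n" for i
  proof -
    have "cmat (sub_A P + sub_B P * F) *\<^sub>v x = a x + cmat (sub_B P) *\<^sub>v (cmat F *\<^sub>v x)"
      using P' F x by (simp add: cmat_add_mult_vec[of _ n n] cmat_mult_vec[of _ n 1 _ n] a_def)
    then show ?thesis
      using i P' F \<zeta> by (simp add: col B_def J_def Q_def D_def c_def f_def del: index_mult_mat_vec)
  qed
  have rx: "rx' = ?rx"
  proof (rule eq_vecI)
    fix i assume "i < dim_vec ?rx"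
    then have i: "i < n" using P' by simp
    show "rx' $ i = ?rx $ i"
      unfolding rx_i[OF i] rx'_i[OF i] u0 y0 c\<xi> f\<xi> by (simp add: algebra_simps)
  qed (use P' in \<open>simp add: rx'_def\<close>)
  have re: "rx' - r\<xi> = ?re"
  proof (rule eq_vecI)
    fix i assume "i < dim_vec ?re"
    then have i: "i < n" using P' L by simp
    have "(rx' - r\<xi>) $ i = rx' $ i - r\<xi> $ i" using i \<kappa> by (simp add: r\<xi>_def)
    also have "\<dots> = ?re $ i"
      unfolding re_i[OF i] rx'_i[OF i] r\<xi>_i[OF i] u0 y0 a\<xi>[OF i] c\<xi> f\<xi> by (simp add: algebra_simps)
    finally show "(rx' - r\<xi>) $ i = ?re $ i" .
  qed (use P' L \<kappa> in \<open>simp add: r\<xi>_def\<close>)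
  have dims: "rx' \<in> carrier_vec n" "r\<xi> \<in> carrier_vec n"
    using P' \<kappa> by (auto simp: rx'_def r\<xi>_def)
  have "mode P ?\<kappa> z x \<xi> \<zeta> \<longleftrightarrow> z \<cdot>\<^sub>v x = rx' \<and> z \<cdot>\<^sub>v \<xi> = r\<xi>"
    unfolding mode_def Let_def rx'_def r\<xi>_def u_def y_def ..
  also have "\<dots> \<longleftrightarrow> z \<cdot>\<^sub>v x = rx' \<and> z \<cdot>\<^sub>v e = rx' - r\<xi>"
    using x e dims by (auto simp: vec_eq_iff \<xi>_def algebra_simps)
  finally show ?thesis unfolding re unfolding rx \<xi>_def by blast
qed

text \<open>In the coordinates e and x the loop is block triangular. Either e is an eigenvector of A
  + L C, or e = 0; then the innovation vanishes, q with it, and x is an eigenvector of A + B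
  F.\<close>

lemma observer_controller_locally_stable:
  assumes P: "is_subsystem n P" and F: "F \<in> carrier_mat 1 n" and L: "L \<in> carrier_mat n 1"
    and stable: "hurwitz (sub_A P + sub_B P * F)" "hurwitz (sub_A P + L * sub_C P)"
  shows "locally_stable P (observer_controller P F L q)"
proof -
  note P' = is_subsystemD[OF P]
  have AF: "sub_A P + sub_B P * F \<in> carrier_mat n n" and AL: "sub_A P + L * sub_C P \<in> carrier_mat n n"
    and JL: "sub_J P + sub_D P \<cdot>\<^sub>m L \<in> carrier_mat n 1"
    using P' F L by auto
  have "Re z < 0" if x: "x \<in> carrier_vec n" and \<xi>: "\<xi> \<in> carrier_vec n"
    and mode: "mode P (observer_controller P F L q) z x \<xi> (0\<^sub>v 1)"
    and nz: "\<not> (x = 0\<^sub>v n \<and> \<xi> = 0\<^sub>v n)" for z x \<xi>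
  proof -
    define e where "e = x - \<xi>"
    have e: "e \<in> carrier_vec n" using x \<xi> by (simp add: e_def)
    have \<xi>_eq: "\<xi> = x - e" using x \<xi> by (intro eq_vecI) (auto simp: e_def)
    have "cmat (sub_J P + sub_D P \<cdot>\<^sub>m L) *\<^sub>v 0\<^sub>v 1 = 0\<^sub>v n" using JL by simp
    then have ze: "z \<cdot>\<^sub>v e = cmat (sub_A P + L * sub_C P) *\<^sub>v e"
      and zx: "z \<cdot>\<^sub>v x = cmat (sub_A P + sub_B P * F) *\<^sub>v x +
        (cmat (sub_B P) *\<^sub>v (complex_of_real q \<cdot>\<^sub>v
          (cmat (sub_C P) *\<^sub>v e + complex_of_real (sub_D P) \<cdot>\<^sub>v 0\<^sub>v 1) - cmat F *\<^sub>v e) + cmat (sub_J P) *\<^sub>v 0\<^sub>v 1)"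
      using mode AL e unfolding \<xi>_eq mode_observer_controller[OF P F L x e zero_carrier_vec]
      by auto
    show ?thesis
    proof (cases "e = 0\<^sub>v n")
      case False
      then show ?thesis using ze e stable(2) hurwitz_iff[OF AL] by metis
    next
      case True
      have "complex_of_real q \<cdot>\<^sub>v (0\<^sub>v 1 + complex_of_real (sub_D P) \<cdot>\<^sub>v 0\<^sub>v 1) - 0\<^sub>v 1 = (0\<^sub>v 1 :: complex vec)"
        by (intro eq_vecI) auto
      then have "z \<cdot>\<^sub>v x = cmat (sub_A P + sub_B P * F) *\<^sub>v x"
        using zx P' F AF x by (simp add: True mult_mat_vec_0[of _ 1 n] mult_mat_vec_0[of _ n 1])
      moreover have "x \<noteq> 0\<^sub>v n" using nz \<xi>_eq True by auto
      ultimately show ?thesis using x stable(1) hurwitz_iff[OF AF] by metis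
    qed
  qed
  then show ?thesis
    using locally_stable_iff[OF P observer_controller_dims[OF P F L]] by blast
qed

section \<open>Tuning the local gain\<close>

text \<open>For amplitude 1 the error e and the innovation are determined before q is chosen.
  \<open>gain_y\<close> says that the innovation is nonzero, so q can set the control input at will;
  \<open>gain_u\<close> says that this input reaches S x.\<close>

lemma unit_gain_mode:
  assumes P: "is_subsystem n P" and F: "F \<in> carrier_mat 1 n" and L: "L \<in> carrier_mat n 1"
    and nilF: "nilpotent_mat (sub_A P + sub_B P * F + 1\<^sub>m n)"
    and nilL: "nilpotent_mat (sub_A P + L * sub_C P + 1\<^sub>m n)"
    and \<sigma>: "\<sigma> > - 1"
    and gain_u: "row (sub_S P) 0 \<bullet> resolvent (sub_A P + sub_B P * F + 1\<^sub>m n) (\<sigma> + 1) (col (sub_B P) 0) \<noteq> 0"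
    and gain_y: "row (sub_C P) 0 \<bullet>
      resolvent (sub_A P + L * sub_C P + 1\<^sub>m n) (\<sigma> + 1) (col (sub_J P + sub_D P \<cdot>\<^sub>m L) 0) + sub_D P \<noteq> 0"
  obtains q x \<xi> where "x \<in> carrier_vec n" "\<xi> \<in> carrier_vec n"
    "mode P (observer_controller P F L q) (complex_of_real \<sigma>) x \<xi> (unit_vec 1 0)"
    "cmat (sub_S P) *\<^sub>v x = unit_vec 1 0"
proof -
  note P' = is_subsystemD[OF P]
  define NF NL where "NF = sub_A P + sub_B P * F + 1\<^sub>m n" and "NL = sub_A P + L * sub_C P + 1\<^sub>m n"
  have AF: "sub_A P + sub_B P * F \<in> carrier_mat n n" and AL: "sub_A P + L * sub_C P \<in> carrier_mat n n"
    and JL: "sub_J P + sub_D P \<cdot>\<^sub>m L \<in> carrier_mat n 1"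
    using P' F L by auto
  have NF: "NF \<in> carrier_mat n n" and NL: "NL \<in> carrier_mat n n"
    using AF AL by (simp_all add: NF_def NL_def)
  define b j jl c s f where "b = col (sub_B P) 0" and "j = col (sub_J P) 0"
    and "jl = col (sub_J P + sub_D P \<cdot>\<^sub>m L) 0" and "c = row (sub_C P) 0" and "s = row (sub_S P) 0" and "f = row F 0"
  have dims: "b \<in> carrier_vec n" "j \<in> carrier_vec n" "jl \<in> carrier_vec n"
    "c \<in> carrier_vec n" "s \<in> carrier_vec n" "f \<in> carrier_vec n"
    using P' F col_carrier_vec[OF _ JL, of 0] by (auto simp: b_def j_def jl_def c_def s_def f_def)
  define e where "e = resolvent NL (\<sigma> + 1) jl"
  have e: "e \<in> carrier_vec n" using NL by (simp add: e_def)
  have ze: "\<sigma> \<cdot>\<^sub>v e = (sub_A P + L * sub_C P) *\<^sub>v e + jl"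
    unfolding e_def NL_def using AL nilL dims \<sigma> by (intro resolvent_shift_eq) auto
  define \<epsilon> where "\<epsilon> = c \<bullet> e + sub_D P"
  have \<epsilon>: "\<epsilon> \<noteq> 0" using gain_y by (simp add: \<epsilon>_def c_def e_def NL_def jl_def)
  define r where "r = resolvent NF\<^sup>T (\<sigma> + 1) s"
  have r: "r \<in> carrier_vec n" using NF by (simp add: r_def)
  have r_eq: "s \<bullet> resolvent NF (\<sigma> + 1) y = r \<bullet> y" if "y \<in> carrier_vec n" for y
    unfolding r_def using NF that dims(5) by (rule resolvent_adjoint)
  have rb: "r \<bullet> b \<noteq> 0" using gain_u r_eq[OF dims(1)] by (simp add: s_def b_def NF_def)
  \<comment> \<open>solves \<open>s \<bullet> x = 1\<close> for the vector \<open>x\<close> below\<close>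
  define q where "q = (1 - r \<bullet> j + (f \<bullet> e) * (r \<bullet> b)) / (\<epsilon> * (r \<bullet> b))"
  define y where "y = (q * \<epsilon> - f \<bullet> e) \<cdot>\<^sub>v b + j"
  have y: "y \<in> carrier_vec n" using dims by (simp add: y_def)
  define x where "x = resolvent NF (\<sigma> + 1) y"
  have x: "x \<in> carrier_vec n" using NF by (simp add: x_def)
  have zx: "\<sigma> \<cdot>\<^sub>v x = (sub_A P + sub_B P * F) *\<^sub>v x + y"
    unfolding x_def NF_def using AF nilF y \<sigma> by (intro resolvent_shift_eq) auto
  have "s \<bullet> x = r \<bullet> y" unfolding x_def using y by (rule r_eq)
  also have "\<dots> = (q * \<epsilon> - f \<bullet> e) * (r \<bullet> b) + r \<bullet> j"
    unfolding y_def using r dims by (simp add: scalar_prod_add_distrib[of _ n])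
  also have "\<dots> = 1" using rb \<epsilon> by (simp add: q_def field_simps)
  finally have sx: "s \<bullet> x = 1" .
  \<comment> \<open>Up to here everything is real because \<sigma> is; the rest transports the two
    equations to the complex vectors of \<open>mode\<close>.\<close>
  define one1 where "one1 = (unit_vec 1 0 :: complex vec)"
  have one1: "one1 \<in> carrier_vec 1" "one1 $ 0 = 1" by (simp_all add: one1_def)
  have row1: "cmat G *\<^sub>v cvec v = complex_of_real (row G 0 \<bullet> v) \<cdot>\<^sub>v one1"
    if "G \<in> carrier_mat 1 n" "v \<in> carrier_vec n" for G v
    unfolding of_real_hom.mult_mat_vec_hom[OF that, symmetric]
    using that by (intro eq_vecI) (auto simp: one1_def)
  have col1: "cmat G *\<^sub>v (a \<cdot>\<^sub>v one1) = a \<cdot>\<^sub>v cvec (col G 0)" if "G \<in> carrier_mat n 1" for G a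
    using that one1
    by (intro eq_vecI) (auto simp: scalar_mult_mat_vec_index[of _ n] simp del: index_mult_mat_vec)
  have cze: "complex_of_real \<sigma> \<cdot>\<^sub>v cvec e = cmat (sub_A P + L * sub_C P) *\<^sub>v cvec e + cmat (sub_J P + sub_D P \<cdot>\<^sub>m L) *\<^sub>v one1"
    using cvec_eq[OF AL e dims(3) ze] col1[OF JL, of 1] by (simp add: jl_def)
  have "cmat (sub_B P) *\<^sub>v (complex_of_real q \<cdot>\<^sub>v
      (cmat (sub_C P) *\<^sub>v cvec e + complex_of_real (sub_D P) \<cdot>\<^sub>v one1) - cmat F *\<^sub>v cvec e) + cmat (sub_J P) *\<^sub>v one1 = cvec y"
  proof -
    have g: "complex_of_real q \<cdot>\<^sub>v (cmat (sub_C P) *\<^sub>v cvec e + complex_of_real (sub_D P) \<cdot>\<^sub>v one1) - cmat F *\<^sub>v cvec e =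
        complex_of_real (q * \<epsilon> - f \<bullet> e) \<cdot>\<^sub>v one1"
      unfolding row1[OF P'(4) e] row1[OF F e] \<epsilon>_def c_def[symmetric] f_def[symmetric]
      using one1(1) by (intro eq_vecI) (auto simp: algebra_simps)
    have h: "cmat (sub_J P) *\<^sub>v one1 = cvec j"
      using col1[OF P'(3), of 1] by (simp add: j_def)
    show ?thesis
      unfolding g h col1[OF P'(2)] b_def[symmetric] y_def using dims by (intro eq_vecI) auto
  qed
  then have czx: "complex_of_real \<sigma> \<cdot>\<^sub>v cvec x = cmat (sub_A P + sub_B P * F) *\<^sub>v cvec x +
      (cmat (sub_B P) *\<^sub>v (complex_of_real q \<cdot>\<^sub>v
      (cmat (sub_C P) *\<^sub>v cvec e + complex_of_real (sub_D P) \<cdot>\<^sub>v one1) - cmat F *\<^sub>v cvec e) + cmat (sub_J P) *\<^sub>v one1)"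
    using cvec_eq[OF AF x y zx] by simp
  have "mode P (observer_controller P F L q) (complex_of_real \<sigma>) (cvec x) (cvec x - cvec e) one1"
    using mode_observer_controller[OF P F L, of "cvec x" "cvec e" one1] x e one1 cze czx by simp
  moreover have "cmat (sub_S P) *\<^sub>v cvec x = one1"
    using row1[OF P'(5) x] sx by (simp add: s_def)
  ultimately show thesis
    using that[of "cvec x" "cvec x - cvec e" q] x e unfolding one1_def by simp
qed

lemma finite_exceptions_unit_gain:
  assumes P: "is_subsystem n P"
    and ctrl: "controllable (sub_A P) (sub_B P)" and obs: "observable (sub_A P) (sub_C P)"
    and S: "sub_S P \<noteq> 0\<^sub>m 1 n" and JD: "sub_J P \<noteq> 0\<^sub>m n 1 \<or> sub_D P \<noteq> 0"
  obtains E where "finite E" "\<And>\<sigma>. \<sigma> > - 1 \<Longrightarrow> \<sigma> \<notin> E \<Longrightarrow>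
    \<exists>\<kappa>\<in>locally_stabilizing P. controller_dims n 1 \<kappa> \<and>
      (\<exists>x\<in>carrier_vec n. \<exists>\<xi>\<in>carrier_vec n.
        mode P \<kappa> (complex_of_real \<sigma>) x \<xi> (unit_vec 1 0) \<and> cmat (sub_S P) *\<^sub>v x = unit_vec 1 0)"
proof -
  note P' = is_subsystemD[OF P]
  have n: "n > 0"
  proof (rule ccontr)
    assume "\<not> n > 0"
    then have "sub_S P = 0\<^sub>m 1 n" using P'(5) by (intro eq_matI) auto
    then show False using S by simp
  qed
  obtain F where F: "F \<in> carrier_mat 1 n" and nilF: "nilpotent_mat (sub_A P + sub_B P * F + 1\<^sub>m n)"
    and cycF: "cyclic_vec (sub_A P + sub_B P * F + 1\<^sub>m n) (col (sub_B P) 0)"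
    using stabilizing_feedback[OF P'(1,2) n controllable_imp_cyclic[OF P'(1,2) ctrl]] by blast
  \<comment> \<open>By duality, the observer gain is the transpose of a state feedback for the pair
    (A^T, C^T).\<close>
  have AT: "(sub_A P)\<^sup>T \<in> carrier_mat n n" and CT: "(sub_C P)\<^sup>T \<in> carrier_mat n 1"
    using P' by auto
  have c: "col (sub_C P)\<^sup>T 0 = row (sub_C P) 0" using P' by simp
  obtain G where G: "G \<in> carrier_mat 1 n"
    and nilG: "nilpotent_mat ((sub_A P)\<^sup>T + (sub_C P)\<^sup>T * G + 1\<^sub>m n)"
    and cycG: "cyclic_vec ((sub_A P)\<^sup>T + (sub_C P)\<^sup>T * G + 1\<^sub>m n) (row (sub_C P) 0)"
    using stabilizing_feedback[OF AT CT n] observable_imp_cyclic[OF P'(1,4) obs] c by metis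
  define L where "L = G\<^sup>T"
  have L: "L \<in> carrier_mat n 1" using G by (simp add: L_def)
  define NF NL where "NF = sub_A P + sub_B P * F + 1\<^sub>m n" and "NL = sub_A P + L * sub_C P + 1\<^sub>m n"
  have AF: "sub_A P + sub_B P * F \<in> carrier_mat n n" and AL: "sub_A P + L * sub_C P \<in> carrier_mat n n"
    and JL: "sub_J P + sub_D P \<cdot>\<^sub>m L \<in> carrier_mat n 1"
    using P' F L by auto
  have NF: "NF \<in> carrier_mat n n" and NL: "NL \<in> carrier_mat n n"
    using AF AL by (simp_all add: NF_def NL_def)
  have NLT: "NL\<^sup>T = (sub_A P)\<^sup>T + (sub_C P)\<^sup>T * G + 1\<^sub>m n"
    using P' G by (simp add: NL_def L_def transpose_add[of _ n n] transpose_mult[of _ n 1 _ n])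
  have nilL: "nilpotent_mat NL"
    using nilpotent_mat_transpose[of "NL\<^sup>T" n] NL nilG by (simp add: NLT[symmetric])
  define b jl c s where "b = col (sub_B P) 0"
    and "jl = col (sub_J P + sub_D P \<cdot>\<^sub>m L) 0" and "c = row (sub_C P) 0" and "s = row (sub_S P) 0"
  have dims: "b \<in> carrier_vec n" "jl \<in> carrier_vec n" "c \<in> carrier_vec n" "s \<in> carrier_vec n"
    using P' col_carrier_vec[OF _ JL, of 0] by (auto simp: b_def jl_def c_def s_def)
  \<comment> \<open>The zeros of the two factors of the slope. The second factor is transposed so
    that the resolvent acts on C, which is known to be cyclic, and not on J + D L.\<close>
  define Z where "Z = {\<mu>. \<mu> \<noteq> 0 \<and> s \<bullet> resolvent NF \<mu> b + 0 = 0} \<union>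
    {\<mu>. \<mu> \<noteq> 0 \<and> jl \<bullet> resolvent NL\<^sup>T \<mu> c + sub_D P = 0}"
  have "s \<noteq> 0\<^sub>v n"
  proof
    assume s0: "s = 0\<^sub>v n"
    have "sub_S P $$ (i,k) = 0" if "i < 1" "k < n" for i k
      using arg_cong[OF s0, of "\<lambda>v. v $ k"] that P'(5) by (simp add: s_def)
    then have "sub_S P = 0\<^sub>m 1 n" using P'(5) by (intro eq_matI) auto
    then show False using S by simp
  qed
  \<comment> \<open>For D = 0 the vector J + D L is J itself, so no choice of L can make both terms
    vanish.\<close>
  moreover have "jl \<noteq> 0\<^sub>v n \<or> sub_D P \<noteq> 0"
  proof (rule ccontr)
    assume "\<not> (jl \<noteq> 0\<^sub>v n \<or> sub_D P \<noteq> 0)"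
    then have jl0: "jl = 0\<^sub>v n" and D0: "sub_D P = 0" by auto
    have "sub_J P $$ (k,i) = 0" if "i < 1" "k < n" for i k
      using arg_cong[OF jl0, of "\<lambda>v. v $ k"] that P'(3) L by (simp add: jl_def D0)
    then have "sub_J P = 0\<^sub>m n 1" using P'(3) by (intro eq_matI) auto
    then show False using JD D0 by simp
  qed
  ultimately have "finite Z"
    unfolding Z_def using NF NL dims nilF cycF nilG cycG
    by (intro finite_UnI finite_zeros_transfer_function[of _ n])
       (simp_all add: NF_def NLT b_def c_def)
  \<comment> \<open>The resolvents are evaluated at \<mu> = \<sigma> + 1, hence the shift back to
    frequencies.\<close>
  then have "finite ((\<lambda>\<mu>. \<mu> - 1) ` Z)" by simp
  moreover have "\<exists>\<kappa>\<in>locally_stabilizing P. controller_dims n 1 \<kappa> \<and>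
      (\<exists>x\<in>carrier_vec n. \<exists>\<xi>\<in>carrier_vec n.
        mode P \<kappa> (complex_of_real \<sigma>) x \<xi> (unit_vec 1 0) \<and> cmat (sub_S P) *\<^sub>v x = unit_vec 1 0)"
    if \<sigma>: "\<sigma> > - 1" "\<sigma> \<notin> (\<lambda>\<mu>. \<mu> - 1) ` Z" for \<sigma>
  proof -
    have "\<sigma> + 1 \<notin> Z" using \<sigma>(2) by force
    then have gain: "s \<bullet> resolvent NF (\<sigma> + 1) b \<noteq> 0" "jl \<bullet> resolvent NL\<^sup>T (\<sigma> + 1) c + sub_D P \<noteq> 0"
      using \<sigma>(1) by (auto simp: Z_def)
    have "jl \<bullet> resolvent NL\<^sup>T (\<sigma> + 1) c = c \<bullet> resolvent NL (\<sigma> + 1) jl"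
      using resolvent_adjoint[OF NL dims(2,3), of "\<sigma> + 1"] NL dims
        comm_scalar_prod[of jl n "resolvent NL\<^sup>T (\<sigma> + 1) c"] by simp
    then obtain q x \<xi> where *: "x \<in> carrier_vec n" "\<xi> \<in> carrier_vec n"
      "mode P (observer_controller P F L q) (complex_of_real \<sigma>) x \<xi> (unit_vec 1 0)"
      "cmat (sub_S P) *\<^sub>v x = unit_vec 1 0"
      using unit_gain_mode[OF P F L nilF nilL[unfolded NL_def] \<sigma>(1)] gain
      unfolding s_def b_def c_def jl_def NF_def NL_def by metis
    have "locally_stable P (observer_controller P F L q)"
      using P F L hurwitz_if_nilpotent[OF AF nilF] hurwitz_if_nilpotent[OF AL nilL[unfolded NL_def]]
      by (rule observer_controller_locally_stable)
    moreover have dim: "controller_dims n 1 (observer_controller P F L q)"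
      using P F L by (rule observer_controller_dims)
    ultimately have "observer_controller P F L q \<in> locally_stabilizing P"
      by (auto simp: locally_stabilizing_def is_local_controller_def controller_dims_def)
    then show ?thesis using dim * by blast
  qed
  ultimately show thesis using that by blast
qed

subsection \<open>Weak resilience\<close>

lemma mode_decoupled:
  assumes P: "is_subsystem n P" and Q: "is_subsystem m Q" and dec: "decoupled_from P Q"
    and w: "w \<in> carrier_vec m"
  shows "mode P \<kappa> z x \<xi> (cmat (sub_S Q) *\<^sub>v w) \<longleftrightarrow> mode P \<kappa> z x \<xi> (0\<^sub>v 1)"
proof -
  note P' = is_subsystemD[OF P] and Q' = is_subsystemD[OF Q]
  have JS: "sub_J P * sub_S Q = 0\<^sub>m n m" and DS: "sub_D P \<cdot>\<^sub>m sub_S Q = 0\<^sub>m 1 m"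
    using dec P' Q' by (auto simp: decoupled_from_def)
  have zero: "cmat (0\<^sub>m k m) *\<^sub>v w = 0\<^sub>v k" for k
    using w by (intro eq_vecI) (auto simp: scalar_prod_def)
  have "cmat (sub_J P) *\<^sub>v (cmat (sub_S Q) *\<^sub>v w) = 0\<^sub>v n"
    using cmat_mult_vec[OF P'(3) Q'(5) w] zero JS by simp
  moreover have "cmat (sub_J P) *\<^sub>v 0\<^sub>v 1 = 0\<^sub>v n" using P' by simp
  moreover have "complex_of_real (sub_D P) \<cdot>\<^sub>v (cmat (sub_S Q) *\<^sub>v w) = 0\<^sub>v 1"
    using cmat_smult_mult_vec[OF Q'(5) w, of "sub_D P"] zero DS by simp
  moreover have "complex_of_real (sub_D P) \<cdot>\<^sub>v 0\<^sub>v 1 = 0\<^sub>v 1" by (intro eq_vecI) auto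
  ultimately show ?thesis unfolding mode_def by simp
qed

text \<open>P receives nothing from Q, so its part is an unforced mode of its own loop. If that part
  is zero, Q receives nothing either, and the remaining part is an unforced mode of the loop of
  Q.\<close>

lemma decoupled_modes_stable:
  assumes P: "is_subsystem n P" and Q: "is_subsystem m Q" and dec: "decoupled_from P Q"
    and \<kappa>: "controller_dims p 1 \<kappa>" "locally_stable P \<kappa>"
    and \<kappa>': "controller_dims q 1 \<kappa>'" "locally_stable Q \<kappa>'"
    and x: "x \<in> carrier_vec n" "\<xi> \<in> carrier_vec p" and w: "w \<in> carrier_vec m" "\<eta> \<in> carrier_vec q"
    and modeP: "mode P \<kappa> z x \<xi> (cmat (sub_S Q) *\<^sub>v w)"
    and modeQ: "mode Q \<kappa>' z w \<eta> (cmat (sub_S P) *\<^sub>v x)"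
    and nz: "\<not> (x = 0\<^sub>v n \<and> w = 0\<^sub>v m \<and> \<xi> = 0\<^sub>v p \<and> \<eta> = 0\<^sub>v q)"
  shows "Re z < 0"
proof (cases "x = 0\<^sub>v n \<and> \<xi> = 0\<^sub>v p")
  case False
  have "mode P \<kappa> z x \<xi> (0\<^sub>v 1)" using modeP mode_decoupled[OF P Q dec w(1)] by simp
  then show ?thesis using False x \<kappa>(2) locally_stable_iff[OF P \<kappa>(1)] by blast
next
  case True
  have "cmat (sub_S P) *\<^sub>v 0\<^sub>v n = 0\<^sub>v 1" using is_subsystemD(5)[OF P] by simp
  then have "mode Q \<kappa>' z w \<eta> (0\<^sub>v 1)" using modeQ True by simp
  moreover have "\<not> (w = 0\<^sub>v m \<and> \<eta> = 0\<^sub>v q)" using nz True by blast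
  ultimately show ?thesis using w \<kappa>'(2) locally_stable_iff[OF Q \<kappa>'(1)] by blast
qed

lemma cascade_imp_weakly_resilient:
  assumes P1: "is_subsystem n1 P1" and P2: "is_subsystem n2 P2" and cas: "cascade P1 P2"
  shows "weakly_resilient P1 P2"
  unfolding weakly_resilient_def
proof (intro ballI)
  fix \<kappa>1 \<kappa>2 assume \<kappa>: "\<kappa>1 \<in> locally_stabilizing P1" "\<kappa>2 \<in> locally_stabilizing P2"
  then obtain q1 q2 where q: "controller_dims q1 1 \<kappa>1" "controller_dims q2 1 \<kappa>2"
    unfolding locally_stabilizing_def is_local_controller_def controller_dims_def by blast
  have st: "locally_stable P1 \<kappa>1" "locally_stable P2 \<kappa>2"
    using \<kappa> by (simp_all add: locally_stabilizing_def)
  show "overall_stable P1 P2 \<kappa>1 \<kappa>2"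
    unfolding overall_stable_iff[OF P1 P2 q]
  proof (intro allI ballI impI)
    fix z x1 x2 \<xi>1 \<xi>2
    assume x: "x1 \<in> carrier_vec n1" "x2 \<in> carrier_vec n2" and \<xi>: "\<xi>1 \<in> carrier_vec q1" "\<xi>2 \<in> carrier_vec q2"
      and modes: "mode P1 \<kappa>1 z x1 \<xi>1 (cmat (sub_S P2) *\<^sub>v x2) \<and> mode P2 \<kappa>2 z x2 \<xi>2 (cmat (sub_S P1) *\<^sub>v x1)"
      and nz: "\<not> ((x1 = 0\<^sub>v n1 \<and> x2 = 0\<^sub>v n2) \<and> \<xi>1 = 0\<^sub>v q1 \<and> \<xi>2 = 0\<^sub>v q2)"
    from cas show "Re z < 0"
      unfolding cascade_def
    proof
      assume "decoupled_from P1 P2"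
      then show ?thesis
        using decoupled_modes_stable[OF P1 P2 _ q(1) st(1) q(2) st(2) x(1) \<xi>(1) x(2) \<xi>(2)] modes nz by blast
    next
      assume "decoupled_from P2 P1"
      then show ?thesis
        using decoupled_modes_stable[OF P2 P1 _ q(2) st(2) q(1) st(1) x(2) \<xi>(2) x(1) \<xi>(1)] modes nz by blast
    qed
  qed
qed

section \<open>Necessity: a destabilizing pair of controllers\<close>

text \<open>Each failing cascade direction yields the S of one subsystem and the (J, D) of the
  other; the two directions together supply what gain tuning requires of both.\<close>

lemma not_decoupledD:
  assumes P: "is_subsystem n P" and Q: "is_subsystem m Q" and dec: "\<not> decoupled_from P Q"
  shows "sub_S Q \<noteq> 0\<^sub>m 1 m" and "sub_J P \<noteq> 0\<^sub>m n 1 \<or> sub_D P \<noteq> 0"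
proof -
  note P' = is_subsystemD[OF P] and Q' = is_subsystemD[OF Q]
  have "decoupled_from P Q" if "sub_S Q = 0\<^sub>m 1 m"
    using P' unfolding decoupled_from_def that
    by (auto intro!: eq_matI)
  then show "sub_S Q \<noteq> 0\<^sub>m 1 m" using dec by blast
  have "decoupled_from P Q" if "sub_J P = 0\<^sub>m n 1" "sub_D P = 0"
    using Q' unfolding decoupled_from_def that by (auto intro!: eq_matI)
  then show "sub_J P \<noteq> 0\<^sub>m n 1 \<or> sub_D P \<noteq> 0" using dec by blast
qed

theorem theorem1:
  fixes n1 n2 :: nat and P1 P2 :: subsystem
  assumes "is_subsystem n1 P1" and "is_subsystem n2 P2"
    and "\<exists>\<kappa>1 \<kappa>2. is_local_controller \<kappa>1 \<and> is_local_controller \<kappa>2 \<and> overall_stable P1 P2 \<kappa>1 \<kappa>2"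
    and "controllable (sub_A P1) (sub_B P1)" and "controllable (sub_A P2) (sub_B P2)"
    and "observable (sub_A P1) (sub_C P1)" and "observable (sub_A P2) (sub_C P2)"
  shows "weakly_resilient P1 P2 \<longleftrightarrow> cascade P1 P2"
proof
  assume "cascade P1 P2"
  then show "weakly_resilient P1 P2" using assms(1,2) by (intro cascade_imp_weakly_resilient)
next
  assume resilient: "weakly_resilient P1 P2"
  show "cascade P1 P2"
  proof (rule ccontr)
    assume "\<not> cascade P1 P2"
    then have dec: "\<not> decoupled_from P1 P2" "\<not> decoupled_from P2 P1"
      by (auto simp: cascade_def)
    note 12 = not_decoupledD[OF assms(1,2) dec(1)] and 21 = not_decoupledD[OF assms(2,1) dec(2)]
    obtain E1 where E1: "finite E1" "\<And>\<sigma>. \<sigma> > - 1 \<Longrightarrow> \<sigma> \<notin> E1 \<Longrightarrow>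
      \<exists>\<kappa>\<in>locally_stabilizing P1. controller_dims n1 1 \<kappa> \<and>
        (\<exists>x\<in>carrier_vec n1. \<exists>\<xi>\<in>carrier_vec n1.
          mode P1 \<kappa> (complex_of_real \<sigma>) x \<xi> (unit_vec 1 0) \<and> cmat (sub_S P1) *\<^sub>v x = unit_vec 1 0)"
      using finite_exceptions_unit_gain[OF assms(1,4,6) 21(1) 12(2)] by blast
    obtain E2 where E2: "finite E2" "\<And>\<sigma>. \<sigma> > - 1 \<Longrightarrow> \<sigma> \<notin> E2 \<Longrightarrow>
      \<exists>\<kappa>\<in>locally_stabilizing P2. controller_dims n2 1 \<kappa> \<and>
        (\<exists>x\<in>carrier_vec n2. \<exists>\<xi>\<in>carrier_vec n2.
          mode P2 \<kappa> (complex_of_real \<sigma>) x \<xi> (unit_vec 1 0) \<and> cmat (sub_S P2) *\<^sub>v x = unit_vec 1 0)"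
      using finite_exceptions_unit_gain[OF assms(2,5,7) 12(1) 21(2)] by blast
    have "infinite ({0<..} - (E1 \<union> E2))"
      using E1(1) E2(1) infinite_Ioi[of "0::real"] by (intro Diff_infinite_finite) auto
    then obtain \<sigma> where \<sigma>: "\<sigma> > 0" "\<sigma> \<notin> E1" "\<sigma> \<notin> E2"
      by (metis (no_types, lifting) DiffE UnCI ex_in_conv finite.emptyI greaterThan_iff)
    obtain \<kappa>1 x1 \<xi>1 where 1: "\<kappa>1 \<in> locally_stabilizing P1" "controller_dims n1 1 \<kappa>1"
      "x1 \<in> carrier_vec n1" "\<xi>1 \<in> carrier_vec n1"
      "mode P1 \<kappa>1 (complex_of_real \<sigma>) x1 \<xi>1 (unit_vec 1 0)" "cmat (sub_S P1) *\<^sub>v x1 = unit_vec 1 0"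
      using E1(2)[of \<sigma>] \<sigma> by force
    obtain \<kappa>2 x2 \<xi>2 where 2: "\<kappa>2 \<in> locally_stabilizing P2" "controller_dims n2 1 \<kappa>2"
      "x2 \<in> carrier_vec n2" "\<xi>2 \<in> carrier_vec n2"
      "mode P2 \<kappa>2 (complex_of_real \<sigma>) x2 \<xi>2 (unit_vec 1 0)" "cmat (sub_S P2) *\<^sub>v x2 = unit_vec 1 0"
      using E2(2)[of \<sigma>] \<sigma> by force
    have "x1 \<noteq> 0\<^sub>v n1"
    proof
      assume "x1 = 0\<^sub>v n1"
      then have "(unit_vec 1 0 :: complex vec) = 0\<^sub>v 1"
        using 1(6) is_subsystemD(5)[OF assms(1)] by simp
      then have "(unit_vec 1 0 :: complex vec) $ 0 = 0\<^sub>v 1 $ 0" by (rule arg_cong)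
      then show False by simp
    qed
    moreover have "overall_stable P1 P2 \<kappa>1 \<kappa>2"
      using resilient 1(1) 2(1) by (simp add: weakly_resilient_def)
    \<comment> \<open>The amplitude \<open>unit_vec 1 0\<close> driving each loop is S x of the
      other, so the two modes fit together into a nonzero overall mode at \<sigma>.\<close>
    ultimately have "Re (complex_of_real \<sigma>) < 0"
      using 1 2 unfolding overall_stable_iff[OF assms(1,2) 1(2) 2(2)] by metis
    then show False using \<sigma>(1) by simp
  qed
qed

end
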